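(* Let $\mu_0\in\mathcal P$ be the reference parameter used to construct the POD space $V^\ell$. There exists a constant $\tilde C>0$, depending on $u_0$, $\alpha$, $\beta(\mu_0)$, $\kappa(\mu_0)$, $L_F(\mu_0)$ and $T$, but independent of the POD dimension $\ell$ and the temporal discretization parameter $m$, such that for every $m$ satisfying the time step condition (S) and every $\ell\in\{1,\dots,n\}$, $$\frac1m\sum_{k=1}^m\|u_0(t_k)-U_k^0\|_H^2\le\tilde C\left(\|\phi-P^\ell\phi\|_H^2+\sum_{j=\ell+1}^n\lambda_j+(\Delta t)^2\right).$$
   Context: **Spaces.** $V,H$ are real separable Hilbert spaces, $V$ densely and compactly embedded in $H$; identifying $H\cong H^*$ gives a Gelfand triple $V\hookrightarrow H\cong H^*\hookrightarrow V^*$. $\alpha>0$ is a constant with $\|\varphi\|_H^2\le\alpha\|\varphi\|_V^2$ for all $\varphi\in V$. $T>0$ is fixed and $W(0,T;V)=\{u\in L^2(0,T;V):\partial_t u\in L^2(0,T;V^* )\}$. **Problem.** $\mathcal P\subset(0,\infty)$ is a fixed compact set, $f\in C([0,T];H)$, $\phi\in V$, $a:V\times V\times\mathbb R_{>0}\to\mathbb R$ is bilinear in its first two arguments, and $F:V\times\mathbb R_{>0}\to H$. For $\mu\in\mathcal P$, $u_\mu\in W(0,T;V)$ solves $$\langle\partial_t u_\mu(t),\psi\rangle_{V^*,V}+a(u_\mu(t),\psi;\mu)+\langle F(u_\mu(t);\mu),\psi\rangle_H=\langle f(t),\psi\rangle_H\quad\forall\psi\in V,\ \text{a.e. }t\in(0,T),\qquad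 u_\mu(0)=\phi.$$ **Standing assumptions.** A modulus of continuity is a nondecreasing $\omega:[0,\infty)\to[0,\infty)$ with $\omega(0)=0$ and $\lim_{r\to0}\omega(r)=0$. There are continuous functions $\beta,\kappa:\mathcal P\to(0,\infty)$, $L_F:\mathcal P\to[0,\infty)$ and moduli of continuity $\omega_a^{\mathcal P},\omega_F^{\mathcal P}$ such that for all $\mu,\nu\in\mathcal P$, $\varphi,\psi,u,v\in V$: - (A1) $|a(\varphi,\psi;\mu)|\le\beta(\mu)\|\varphi\|_V\|\psi\|_V$; - (A2) $a(\varphi,\varphi;\mu)\ge\kappa(\mu)\|\varphi\|_V^2$; - (A3) $|a(\varphi,\psi;\mu)-a(\varphi,\psi;\nu)|\le\omega_a^{\mathcal P}(|\mu-\nu|)\|\varphi\|_V\|\psi\|_V$; - (F1) $\|F(u;\mu)-F(v;\mu)\|_H\le L_F(\mu)\|u-v\|_V$; - (F2) $\|F(u;\mu)-F(u;\nu)\|_H\le\omega_F^{\mathcal P}(|\mu-\nu|)(\|u\|_V+1)$. For every $\mu\in\mathcal P$ the problem has a unique solution $u_\mu\in W(0,T;V)\cap C([0,T];H)$, and moreover $u_\mu\in W^{2,2}(0,T;H)\cap C([0,T];V)$ (so $\partial_tu_\mu\in C([0,T];H)$ and the duality pairing is identified with the $H$-inner product). **Notation.** $\underline\kappa_{\mathcal P}=\inf_{\mathcal P}\kappa>0$, $\overline L_{F,\mathcal P}=\sup_{\mathcal P}L_F<\infty$. Write $u_0=u_{\mu_0}$. For a positive integer $m$: $\Delta t=T/m$,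 $t_k=k\Delta t$, and $\overline\partial w_k=(w_k-w_{k-1})/\Delta t$ (with $w_k=w(t_k)$ for a function $w$ of time). **Time step condition (S).** $1-\frac{\overline L_{F,\mathcal P}^2}{\underline\kappa_{\mathcal P}}\Delta t\ge\frac12$ and $1-\left(1+L_F(\mu_0)+\frac{L_F(\mu_0)^2}{2\kappa(\mu_0)}\right)\Delta t\ge\frac12$. **POD space.** The snapshots are $y_j=u_0(t_j)$ for $j=0,\dots,m$ and $y_j=\overline\partial u_0(t_{j-m})=(u_0(t_{j-m})-u_0(t_{j-m-1}))/\Delta t$ for $j=m+1,\dots,2m$. Let $n$ be the dimension of their span, and let $\lambda_1\ge\dots\ge\lambda_n>0$ be the positive eigenvalues of the $(2m+1)\times(2m+1)$ matrix $K_{ij}=\frac1{2m+1}\langle y_i,y_j\rangle_V$, with corresponding orthonormal eigenvectors $v_1,\dots,v_n$. The POD basis is $\psi_k=\frac1{\sqrt{(2m+1)\lambda_k}}\sum_{j=0}^{2m}(v_k)_jy_j$, $1\le k\le\ell$, $\ell\in\{1,\dots,n\}$; it is $V$-orthonormal and minimizes $\frac1{2m+1}\sum_{j=0}^{2m}\|y_j-\sum_{k=1}^\ell\langle y_j,\psi_k\rangle_V\psi_k\|_V^2$ over $V$-orthonormal families, with minimum value $\sum_{j=\ell+1}^n\lambda_j$. Set $V^\ell=\mathrm{span}\{\psi_1,\dots,\psi_\ell\}$. **Ritz projection.** $P^\ell:V\to V^\ell$ is defined by $a(P^\ell v,\psi;\mu_0)=a(v,\psi;\mu_0)$ for all $\psi\in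 V^\ell$. **Reduced-order scheme.** $\{U_k^0\}_{k=0}^m\subset V^\ell$ satisfies, for all $\psi\in V^\ell$, $\langle U_0^0,\psi\rangle_H=\langle\phi,\psi\rangle_H$ and, for $k=1,\dots,m$, $$\langle\overline\partial U_k^0,\psi\rangle_H+a(U_k^0,\psi;\mu_0)+\langle F(U_k^0;\mu_0),\psi\rangle_H=\langle f(t_k),\psi\rangle_H.$$ *)

theory Defs
  imports "HOL-Analysis.Analysis"
begin

text \<open>
  On a second countable (separable) Banach space Borel measurability is strong measurability, so
  this is the Bochner space. It is also used for functions with values in the dual space
  \<open>'v \<Rightarrow>\<^sub>L real\<close> of a separable Hilbert space, which is separable as well although it is not
  registered as an instance of the type class.
\<close>

definition in_L2 :: "real \<Rightarrow> (real \<Rightarrow> 'a::real_normed_vector) \<Rightarrow> bool" where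
  "in_L2 T w \<longleftrightarrow>
     w \<in> borel_measurable (lebesgue_on {0<..<T}) \<and>
     integrable (lebesgue_on {0<..<T}) (\<lambda>t. (norm (w t))\<^sup>2)"

definition test_function :: "real \<Rightarrow> (real \<Rightarrow> real) \<Rightarrow> bool" where
  "test_function T \<eta> \<longleftrightarrow>
     (\<forall>k x. (deriv ^^ k) \<eta> field_differentiable (at x)) \<and>
     closure {t. \<eta> t \<noteq> 0} \<subseteq> {0<..<T}"

definition weak_derivative ::
    "real \<Rightarrow> (real \<Rightarrow> 'h::{banach,second_countable_topology}) \<Rightarrow> (real \<Rightarrow> 'h) \<Rightarrow> bool" where
  "weak_derivative T w g \<longleftrightarrow>
     (\<forall>\<eta>. test_function T \<eta> \<longrightarrow>
        integral\<^sup>L (lebesgue_on {0<..<T}) (\<lambda>t. deriv \<eta> t *\<^sub>R w t) =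
        - integral\<^sup>L (lebesgue_on {0<..<T}) (\<lambda>t. \<eta> t *\<^sub>R g t))"

definition in_W22 :: "real \<Rightarrow> (real \<Rightarrow> 'h::{banach,second_countable_topology}) \<Rightarrow> bool" where
  "in_W22 T w \<longleftrightarrow>
     in_L2 T w \<and>
     (\<exists>w' w''. in_L2 T w' \<and> in_L2 T w'' \<and> weak_derivative T w w' \<and> weak_derivative T w' w'')"

text \<open>The inclusion of \<open>V\<close> in \<open>H\<close> is an explicit map \<open>emb\<close> between two types.\<close>

locale gelfand_triple =
  fixes emb :: "'v::{real_inner,banach,second_countable_topology}
                  \<Rightarrow> 'h::{real_inner,banach,second_countable_topology}"
  assumes emb_bounded_linear: "bounded_linear emb"
    and emb_inj: "inj emb"
    and emb_dense: "closure (range emb) = UNIV"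
    and emb_compact: "\<And>B. bounded B \<Longrightarrow> compact (closure (emb ` B))"

text \<open>
  The time derivative of a \<open>V\<close>-valued function as a \<open>V\<^sup>*\<close>-valued one: \<open>w t\<close> is regarded as the
  functional \<open>\<lambda>\<psi>. inner (emb (w t)) (emb \<psi>)\<close>. The defining identity between Bochner integrals
  in \<open>V\<^sup>*\<close> is written after evaluation at an arbitrary \<open>\<psi>\<close>, which commutes with the integrals.
\<close>

definition dual_weak_derivative ::
    "('v::{real_inner,banach,second_countable_topology}
        \<Rightarrow> 'h::{real_inner,banach,second_countable_topology})
      \<Rightarrow> real \<Rightarrow> (real \<Rightarrow> 'v) \<Rightarrow> (real \<Rightarrow> 'v \<Rightarrow>\<^sub>L real) \<Rightarrow> bool" where
  "dual_weak_derivative emb T w g \<longleftrightarrow>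
     (\<forall>\<eta> \<psi>. test_function T \<eta> \<longrightarrow>
        integral\<^sup>L (lebesgue_on {0<..<T}) (\<lambda>t. deriv \<eta> t * inner (emb (w t)) (emb \<psi>)) =
        - integral\<^sup>L (lebesgue_on {0<..<T}) (\<lambda>t. \<eta> t * blinfun_apply (g t) \<psi>))"

text \<open>
  Solutions in \<open>W(0,T;V) \<inter> C([0,T];H)\<close> for the parameter \<open>\<mu>\<close>. The function \<open>w\<close> stands for its
  class modulo null sets; \<open>wH\<close> is the continuous \<open>H\<close>-valued representative, which carries the
  initial value.
\<close>

definition is_solution ::
    "('v::{real_inner,banach,second_countable_topology}
        \<Rightarrow> 'h::{real_inner,banach,second_countable_topology})
      \<Rightarrow> real \<Rightarrow> (real \<Rightarrow> 'h) \<Rightarrow> 'v \<Rightarrow> ('v \<Rightarrow> 'v \<Rightarrow> real \<Rightarrow> real) \<Rightarrow> ('v \<Rightarrow> real \<Rightarrow> 'h)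
      \<Rightarrow> real \<Rightarrow> (real \<Rightarrow> 'v) \<Rightarrow> bool" where
  "is_solution emb T f \<phi> a F \<mu> w \<longleftrightarrow>
     in_L2 T w \<and>
     (\<exists>g. in_L2 T g \<and> dual_weak_derivative emb T w g \<and>
        (\<forall>\<psi>. AE t in lebesgue_on {0<..<T}.
            blinfun_apply (g t) \<psi> + a (w t) \<psi> \<mu> + inner (F (w t) \<mu>) (emb \<psi>)
              = inner (f t) (emb \<psi>))) \<and>
     (\<exists>wH. continuous_on {0..T} wH \<and>
        (AE t in lebesgue_on {0<..<T}. wH t = emb (w t)) \<and>
        wH 0 = emb \<phi>)"

definition modulus_of_continuity :: "(real \<Rightarrow> real) \<Rightarrow> bool" where
  "modulus_of_continuity \<omega> \<longleftrightarrow>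
     mono_on {0..} \<omega> \<and> (\<forall>r\<ge>0. \<omega> r \<ge> 0) \<and> \<omega> 0 = 0 \<and> (\<omega> \<longlongrightarrow> 0) (at_right 0)"

locale parametrized_problem = gelfand_triple emb
  for emb :: "'v::{real_inner,banach,second_countable_topology}
                \<Rightarrow> 'h::{real_inner,banach,second_countable_topology}" +
  fixes \<alpha> T :: real
    and P :: "real set"
    and f :: "real \<Rightarrow> 'h"
    and \<phi> :: 'v
    and a :: "'v \<Rightarrow> 'v \<Rightarrow> real \<Rightarrow> real"
    and F :: "'v \<Rightarrow> real \<Rightarrow> 'h"
    and \<beta> \<kappa> L\<^sub>F \<omega>\<^sub>a \<omega>\<^sub>F :: "real \<Rightarrow> real"
    and u :: "real \<Rightarrow> real \<Rightarrow> 'v"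
  assumes \<alpha>_pos: "\<alpha> > 0"
    and emb_bound: "\<And>v. (norm (emb v))\<^sup>2 \<le> \<alpha> * (norm v)\<^sup>2"
    and T_pos: "T > 0"
    and P_compact: "compact P"
    and P_pos: "P \<subseteq> {0<..}"
    and f_cont: "continuous_on {0..T} f"
    and a_bilinear: "\<And>\<mu>. \<mu> > 0 \<Longrightarrow> bilinear (\<lambda>v w. a v w \<mu>)"
    and \<beta>: "continuous_on P \<beta>" "\<And>\<mu>. \<mu> \<in> P \<Longrightarrow> \<beta> \<mu> > 0"
    and \<kappa>: "continuous_on P \<kappa>" "\<And>\<mu>. \<mu> \<in> P \<Longrightarrow> \<kappa> \<mu> > 0"
    and L\<^sub>F: "continuous_on P L\<^sub>F" "\<And>\<mu>. \<mu> \<in> P \<Longrightarrow> L\<^sub>F \<mu> \<ge> 0"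
    and \<omega>: "modulus_of_continuity \<omega>\<^sub>a" "modulus_of_continuity \<omega>\<^sub>F"
    and A1: "\<And>\<mu> v w. \<mu> \<in> P \<Longrightarrow> \<bar>a v w \<mu>\<bar> \<le> \<beta> \<mu> * norm v * norm w"
    and A2: "\<And>\<mu> v. \<mu> \<in> P \<Longrightarrow> a v v \<mu> \<ge> \<kappa> \<mu> * (norm v)\<^sup>2"
    and A3: "\<And>\<mu> \<nu> v w. \<mu> \<in> P \<Longrightarrow> \<nu> \<in> P \<Longrightarrow>
               \<bar>a v w \<mu> - a v w \<nu>\<bar> \<le> \<omega>\<^sub>a \<bar>\<mu> - \<nu>\<bar> * norm v * norm w"
    and F1: "\<And>\<mu> v w. \<mu> \<in> P \<Longrightarrow> norm (F v \<mu> - F w \<mu>) \<le> L\<^sub>F \<mu> * norm (v - w)"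
    and F2: "\<And>\<mu> \<nu> v. \<mu> \<in> P \<Longrightarrow> \<nu> \<in> P \<Longrightarrow>
               norm (F v \<mu> - F v \<nu>) \<le> \<omega>\<^sub>F \<bar>\<mu> - \<nu>\<bar> * (norm v + 1)"
    and u_solution: "\<And>\<mu>. \<mu> \<in> P \<Longrightarrow> is_solution emb T f \<phi> a F \<mu> (u \<mu>)"
    and u_unique: "\<And>\<mu> w. \<mu> \<in> P \<Longrightarrow> is_solution emb T f \<phi> a F \<mu> w \<Longrightarrow>
               (AE t in lebesgue_on {0<..<T}. w t = u \<mu> t)"
    and u_W22: "\<And>\<mu>. \<mu> \<in> P \<Longrightarrow> in_W22 T (\<lambda>t. emb (u \<mu> t))"
    and u_cont: "\<And>\<mu>. \<mu> \<in> P \<Longrightarrow> continuous_on {0..T} (u \<mu>)"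

definition time_step :: "real \<Rightarrow> nat \<Rightarrow> real" where
  "time_step T m = T / real m"

definition time_node :: "real \<Rightarrow> nat \<Rightarrow> nat \<Rightarrow> real" where
  "time_node T m k = real k * time_step T m"

text \<open>Only used for \<open>k \<ge> 1\<close>.\<close>

definition backward_diff :: "real \<Rightarrow> nat \<Rightarrow> (nat \<Rightarrow> 'a::real_vector) \<Rightarrow> nat \<Rightarrow> 'a" where
  "backward_diff T m w k = (w k - w (k - 1)) /\<^sub>R time_step T m"

definition time_step_condition ::
    "real \<Rightarrow> real set \<Rightarrow> (real \<Rightarrow> real) \<Rightarrow> (real \<Rightarrow> real) \<Rightarrow> real \<Rightarrow> nat \<Rightarrow> bool" where
  "time_step_condition T P \<kappa> L\<^sub>F \<mu>\<^sub>0 m \<longleftrightarrow>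
     1 - (SUP \<mu>\<in>P. L\<^sub>F \<mu>)\<^sup>2 / (INF \<mu>\<in>P. \<kappa> \<mu>) * time_step T m \<ge> 1 / 2 \<and>
     1 - (1 + L\<^sub>F \<mu>\<^sub>0 + (L\<^sub>F \<mu>\<^sub>0)\<^sup>2 / (2 * \<kappa> \<mu>\<^sub>0)) * time_step T m \<ge> 1 / 2"

definition snapshot :: "real \<Rightarrow> nat \<Rightarrow> (real \<Rightarrow> 'v::real_vector) \<Rightarrow> nat \<Rightarrow> 'v" where
  "snapshot T m u\<^sub>0 j =
     (if j \<le> m then u\<^sub>0 (time_node T m j)
      else backward_diff T m (\<lambda>k. u\<^sub>0 (time_node T m k)) (j - m))"

definition snapshot_dim :: "nat \<Rightarrow> (nat \<Rightarrow> 'v::real_vector) \<Rightarrow> nat" where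
  "snapshot_dim m y = dim (span (y ` {0..2 * m}))"

text \<open>
  Matrices and vectors of size \<open>2m+1\<close> are functions of indices ranging over \<open>{0..2 * m}\<close>.
\<close>

definition correlation_matrix :: "nat \<Rightarrow> (nat \<Rightarrow> 'v::real_inner) \<Rightarrow> nat \<Rightarrow> nat \<Rightarrow> real" where
  "correlation_matrix m y i j = inner (y i) (y j) / real (2 * m + 1)"

definition matrix_eigenvector ::
    "nat \<Rightarrow> (nat \<Rightarrow> nat \<Rightarrow> real) \<Rightarrow> (nat \<Rightarrow> real) \<Rightarrow> real \<Rightarrow> bool" where
  "matrix_eigenvector m K x c \<longleftrightarrow>
     (\<exists>i\<in>{0..2 * m}. x i \<noteq> 0) \<and> (\<forall>i\<in>{0..2 * m}. (\<Sum>j=0..2 * m. K i j * x j) = c * x i)"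

text \<open>
  \<open>lam 1 \<ge> \<dots> \<ge> lam n > 0\<close> are the positive eigenvalues, \<open>ev 1, \<dots>, ev n\<close> orthonormal
  eigenvectors. For the correlation matrix, whose rank is \<open>n\<close>, having \<open>n\<close> orthonormal
  eigenvectors means that every positive eigenvalue is listed with its multiplicity.
\<close>

definition positive_eigensystem ::
    "nat \<Rightarrow> (nat \<Rightarrow> nat \<Rightarrow> real) \<Rightarrow> nat \<Rightarrow> (nat \<Rightarrow> real) \<Rightarrow> (nat \<Rightarrow> nat \<Rightarrow> real) \<Rightarrow> bool" where
  "positive_eigensystem m K n lam ev \<longleftrightarrow>
     lam ` {1..n} = {c. c > 0 \<and> (\<exists>x. matrix_eigenvector m K x c)} \<and>
     (\<forall>k\<in>{1..n}. \<forall>l\<in>{1..n}. k \<le> l \<longrightarrow> lam l \<le> lam k) \<and>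
     (\<forall>k\<in>{1..n}. matrix_eigenvector m K (ev k) (lam k)) \<and>
     (\<forall>k\<in>{1..n}. \<forall>l\<in>{1..n}. (\<Sum>j=0..2 * m. ev k j * ev l j) = (if k = l then 1 else 0))"

definition pod_basis ::
    "nat \<Rightarrow> (nat \<Rightarrow> 'v::real_vector) \<Rightarrow> (nat \<Rightarrow> real) \<Rightarrow> (nat \<Rightarrow> nat \<Rightarrow> real) \<Rightarrow> nat \<Rightarrow> 'v" where
  "pod_basis m y lam ev k =
     (1 / sqrt (real (2 * m + 1) * lam k)) *\<^sub>R (\<Sum>j=0..2 * m. ev k j *\<^sub>R y j)"

definition pod_space ::
    "nat \<Rightarrow> (nat \<Rightarrow> 'v::real_vector) \<Rightarrow> (nat \<Rightarrow> real) \<Rightarrow> (nat \<Rightarrow> nat \<Rightarrow> real) \<Rightarrow> nat \<Rightarrow> 'v set" where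
  "pod_space m y lam ev l = span (pod_basis m y lam ev ` {1..l})"

text \<open>
  Well defined on a finite-dimensional subspace \<open>S\<close> by coercivity of \<open>a\<close>.
\<close>

definition ritz_projection ::
    "('v \<Rightarrow> 'v \<Rightarrow> real \<Rightarrow> real) \<Rightarrow> real \<Rightarrow> 'v set \<Rightarrow> 'v \<Rightarrow> 'v" where
  "ritz_projection a \<mu>\<^sub>0 S v = (THE w. w \<in> S \<and> (\<forall>\<psi>\<in>S. a w \<psi> \<mu>\<^sub>0 = a v \<psi> \<mu>\<^sub>0))"

definition reduced_scheme ::
    "('v::real_vector \<Rightarrow> 'h::real_inner) \<Rightarrow> real \<Rightarrow> (real \<Rightarrow> 'h) \<Rightarrow> 'v \<Rightarrow> ('v \<Rightarrow> 'v \<Rightarrow> real \<Rightarrow> real)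
      \<Rightarrow> ('v \<Rightarrow> real \<Rightarrow> 'h) \<Rightarrow> real \<Rightarrow> nat \<Rightarrow> 'v set \<Rightarrow> (nat \<Rightarrow> 'v) \<Rightarrow> bool" where
  "reduced_scheme emb T f \<phi> a F \<mu>\<^sub>0 m S U \<longleftrightarrow>
     (\<forall>k\<in>{0..m}. U k \<in> S) \<and>
     (\<forall>\<psi>\<in>S. inner (emb (U 0)) (emb \<psi>) = inner (emb \<phi>) (emb \<psi>)) \<and>
     (\<forall>k\<in>{1..m}. \<forall>\<psi>\<in>S.
        inner (emb (backward_diff T m U k)) (emb \<psi>) + a (U k) \<psi> \<mu>\<^sub>0
          + inner (F (U k) \<mu>\<^sub>0) (emb \<psi>)
        = inner (f (time_node T m k)) (emb \<psi>))"

end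

theory Submission
  imports Defs
begin

text \<open>
  Write \<open>R\<close> for the Ritz projection and split the error as
  \<open>u(t\<^sub>k) - U\<^sub>k = \<rho>\<^sub>k - \<theta>\<^sub>k\<close> with \<open>\<rho>\<^sub>k = u(t\<^sub>k) - R u(t\<^sub>k)\<close> and
  \<open>\<theta>\<^sub>k = U\<^sub>k - R u(t\<^sub>k)\<close>, which lies in the POD space.

  The projection errors \<open>\<rho>\<^sub>k\<close> and their difference quotients are the Ritz errors of the snapshots,
  because \<open>R\<close> is linear; this is why difference quotients belong to the snapshot set. By Cea's
  inequality (\<open>cea_estimate\<close>) they are at most \<open>\<beta>/\<kappa>\<close> times the distance of the
  snapshots to the POD space, whose sum of squares is \<open>2m+1\<close> times the sum of
  the neglected eigenvalues (\<open>pod_truncation_error\<close>).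

  The part \<open>\<theta>\<^sub>k\<close> satisfies a discrete parabolic equation in which the form sees only \<open>\<theta>\<^sub>k\<close>,
  since \<open>R\<close> removes \<open>\<rho>\<^sub>k\<close> from it. Testing this equation with \<open>\<theta>\<^sub>k\<close> and absorbing the gradient
  part of the nonlinearity into the coercivity gives a one-step inequality
  (\<open>discrete_error_step\<close>); the step size condition keeps the coefficient of
  \<open>\<parallel>\<theta>\<^sub>k\<parallel>\<^sub>H\<^sup>2\<close> at least one half, and a discrete Gronwall argument sums the inequalities
  (\<open>discrete_error_bound\<close>). The initial value \<open>\<theta>\<^sub>0\<close> is the \<open>H\<close>-orthogonal projection of
  \<open>\<phi> - R \<phi>\<close> to the POD space.

  What remains is the consistency error of the backward difference quotient. Tested with \<open>\<psi>\<close>, the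
  time derivative of \<open>u\<close> is the continuous function
  \<open>q(t) = \<langle>f(t),\<psi>\<rangle> - a(u(t),\<psi>) - \<langle>F(u(t)),\<psi>\<rangle>\<close>, and the weak derivative of \<open>q\<close> is
  \<open>\<langle>u''(t),\<psi>\<rangle>\<close>. So the fundamental theorem of calculus is needed only for
  continuous scalar functions with an integrable weak derivative; for them it follows
  by testing with smoothed indicator functions of intervals (\<open>weak_derivative_increment\<close>).
  Hence the consistency error on the \<open>k\<close>-th time interval is at most the integral of
  \<open>\<parallel>u''\<parallel>\<^sub>H\<close> over it (\<open>difference_quotient_consistency\<close>), and by the Cauchy-Schwarz inequality the squares of
  these integrals add up to at most \<open>\<Delta>t\<close> times the squared \<open>L\<^sup>2\<close> norm of \<open>u''\<close>
  (\<open>sum_total_variation_square_le\<close>). That norm is the only way in which the solution enters the constant.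
\<close>

section \<open>Smooth cut-off functions\<close>

text \<open>
  The function \<open>exp (-1/x)\<close>, extended by zero, has derivatives of the form polynomial in \<open>1/x\<close> times
  the function itself. The factors \<open>(1/x)\<^sup>k\<close> make this family closed under differentiation up to
  linear combinations.
\<close>

definition flat :: "nat \<Rightarrow> real \<Rightarrow> real" where
  "flat k x = (if x \<le> 0 then 0 else inverse x ^ k * exp (- inverse x))"

lemma flat_tendsto_0: "(flat k \<longlongrightarrow> 0) (at_right 0)"
proof -
  have "((\<lambda>x. (inverse x) ^ k / exp (inverse x)) \<longlongrightarrow> (0::real)) (at_right 0)"
    by (rule filterlim_compose[OF tendsto_power_div_exp_0 filterlim_inverse_at_top_right])
  then show ?thesis
    by (rule Lim_transform_eventually)
       (auto simp: flat_def exp_minus field_simps eventually_at_filter)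
qed

lemma flat_has_derivative:
  "(flat k has_field_derivative (flat (k + 2) x - real k * flat (k + 1) x)) (at x)"
proof -
  consider "x < 0" | "x > 0" | "x = 0" by linarith
  then show ?thesis
  proof cases
    case 1
    have "(flat k has_field_derivative 0) (at x)"
      by (rule has_field_derivative_transform_within_open[of "\<lambda>_. 0" _ _ "{..<0}"])
         (use 1 in \<open>auto simp: flat_def\<close>)
    then show ?thesis using 1 by (simp add: flat_def)
  next
    case 2
    have "((\<lambda>x. inverse x ^ k * exp (- inverse x)) has_field_derivative
             (flat (k + 2) x - real k * flat (k + 1) x)) (at x)"
    proof (cases k)
      case 0
      then show ?thesis
        using 2 by (auto intro!: derivative_eq_intros simp: flat_def field_simps power2_eq_square)
    next
      case (Suc j)
      have "((\<lambda>x. inverse x ^ Suc j * exp (- inverse x)) has_field_derivative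
              (real (Suc j) * inverse x ^ j * (- (inverse x * inverse x)) * exp (- inverse x)
               + inverse x ^ Suc j * (exp (- inverse x) * (inverse x * inverse x)))) (at x)"
        using 2 by (auto intro!: derivative_eq_intros simp del: power_Suc)
      moreover have "real (Suc j) * inverse x ^ j * (- (inverse x * inverse x)) * exp (- inverse x)
               + inverse x ^ Suc j * (exp (- inverse x) * (inverse x * inverse x))
             = flat (k + 2) x - real k * flat (k + 1) x"
        using 2 Suc by (simp add: flat_def algebra_simps)
      ultimately show ?thesis by (simp only: Suc)
    qed
    then show ?thesis
      by (rule has_field_derivative_transform_within_open[of _ _ _ "{0<..}"])
         (use 2 in \<open>auto simp: flat_def\<close>)
  next
    case 3
    have "((\<lambda>h. (flat k (0 + h) - flat k 0) / h) \<longlongrightarrow> 0) (at 0)"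
      proof (rule filterlim_split_at)
        show "((\<lambda>h. (flat k (0 + h) - flat k 0) / h) \<longlongrightarrow> 0) (at_left 0)"
          by (rule Lim_transform_eventually[OF tendsto_const])
             (auto simp: flat_def eventually_at_filter)
        show "((\<lambda>h. (flat k (0 + h) - flat k 0) / h) \<longlongrightarrow> 0) (at_right 0)"
          by (rule Lim_transform_eventually[OF flat_tendsto_0[of "k + 1"]])
             (auto simp: flat_def eventually_at_filter field_simps)
      qed
    then show ?thesis using 3 by (simp add: DERIV_def flat_def)
  qed
qed

text \<open>
  A class of functions that contains the cut-offs built from \<open>flat\<close> and is closed under
  \<open>deriv\<close>. Closure makes every member differentiable infinitely often without computing any higher
  derivative.
\<close>

inductive smooth_gen :: "(real \<Rightarrow> real) \<Rightarrow> bool" where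
  flat: "smooth_gen (flat k)"
| const: "smooth_gen (\<lambda>_. c)"
| add: "smooth_gen f \<Longrightarrow> smooth_gen g \<Longrightarrow> smooth_gen (\<lambda>x. f x + g x)"
| mult: "smooth_gen f \<Longrightarrow> smooth_gen g \<Longrightarrow> smooth_gen (\<lambda>x. f x * g x)"
| affine: "smooth_gen f \<Longrightarrow> smooth_gen (\<lambda>x. f (c * x + d))"
| inverse: "smooth_gen f \<Longrightarrow> (\<And>x. f x \<noteq> 0) \<Longrightarrow> smooth_gen (\<lambda>x. inverse (f x))"

lemma smooth_gen_cmult: "smooth_gen f \<Longrightarrow> smooth_gen (\<lambda>x. c * f x)"
  by (intro smooth_gen.mult smooth_gen.const)

lemma smooth_gen_derivative:
  assumes "smooth_gen f"
  shows "\<exists>g. smooth_gen g \<and> (\<forall>x. (f has_field_derivative g x) (at x))"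
  using assms
proof induction
  case (flat k)
  have "smooth_gen (\<lambda>x. flat (k + 2) x + (- real k) * flat (k + 1) x)"
    by (intro smooth_gen.add smooth_gen_cmult smooth_gen.flat)
  moreover have "\<forall>x. (flat k has_field_derivative flat (k + 2) x + (- real k) * flat (k + 1) x) (at x)"
    using flat_has_derivative[of k] by simp
  ultimately show ?case by blast
next
  case (const c)
  show ?case
    by (rule exI[of _ "\<lambda>_. 0"]) (auto intro: smooth_gen.const)
next
  case (add f g)
  then obtain f' g' where "smooth_gen f'" "smooth_gen g'"
    "\<And>x. (f has_field_derivative f' x) (at x)" "\<And>x. (g has_field_derivative g' x) (at x)"
    by blast
  then show ?case
    by (intro exI[of _ "\<lambda>x. f' x + g' x"]) (auto intro: smooth_gen.add DERIV_add)
next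
  case (mult f g)
  then obtain f' g' where "smooth_gen f'" "smooth_gen g'"
    "\<And>x. (f has_field_derivative f' x) (at x)" "\<And>x. (g has_field_derivative g' x) (at x)"
    by blast
  with mult show ?case
    by (intro exI[of _ "\<lambda>x. f' x * g x + g' x * f x"])
       (auto intro!: smooth_gen.add smooth_gen.mult DERIV_mult)
next
  case (affine f c d)
  then obtain f' where f': "smooth_gen f'" "\<And>x. (f has_field_derivative f' x) (at x)"
    by blast
  have "((\<lambda>x. f (c * x + d)) has_field_derivative c * f' (c * x + d)) (at x)" for x
  proof -
    have "((\<lambda>x. c * x + d) has_field_derivative c) (at x)"
      by (auto intro!: derivative_eq_intros)
    from DERIV_chain2[OF f'(2) this] show ?thesis by (simp add: mult.commute)
  qed
  with f' show ?case
    by (intro exI[of _ "\<lambda>x. c * f' (c * x + d)"])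
       (auto intro!: smooth_gen_cmult smooth_gen.affine)
next
  case (inverse f)
  then obtain f' where f': "smooth_gen f'" "\<And>x. (f has_field_derivative f' x) (at x)"
    by blast
  have "((\<lambda>x. inverse (f x)) has_field_derivative (- 1) * (f' x * (inverse (f x) * inverse (f x)))) (at x)" for x
    using inverse.hyps(2) by (auto intro!: derivative_eq_intros f'(2))
  moreover have "smooth_gen (\<lambda>x. (- 1) * (f' x * (inverse (f x) * inverse (f x))))"
    using f' inverse by (intro smooth_gen_cmult smooth_gen.mult smooth_gen.inverse) auto
  ultimately show ?case by blast
qed

lemma smooth_gen_deriv:
  assumes "smooth_gen f"
  shows "smooth_gen (deriv f)" "(f has_field_derivative deriv f x) (at x)"
proof -
  obtain g where g: "smooth_gen g" "\<And>x. (f has_field_derivative g x) (at x)"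
    using smooth_gen_derivative[OF assms] by blast
  then have "deriv f = g" by (auto intro!: ext DERIV_imp_deriv)
  with g show "smooth_gen (deriv f)" "(f has_field_derivative deriv f x) (at x)" by auto
qed

lemma smooth_gen_funpow_deriv: "smooth_gen f \<Longrightarrow> smooth_gen ((deriv ^^ k) f)"
  by (induction k) (auto intro: smooth_gen_deriv)

lemma smooth_gen_continuous: "smooth_gen f \<Longrightarrow> continuous_on S f"
  using smooth_gen_deriv(2) DERIV_isCont continuous_at_imp_continuous_on by blast

lemma test_functionI:
  assumes "smooth_gen \<eta>" "\<And>t. t \<notin> {c..d} \<Longrightarrow> \<eta> t = 0" "0 < c" "d < T"
  shows "test_function T \<eta>"
proof -
  have "closure {t. \<eta> t \<noteq> 0} \<subseteq> {c..d}"
    by (rule closure_minimal) (use assms(2) in blast, simp)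
  moreover have "(deriv ^^ k) \<eta> field_differentiable (at x)" for k x
    using smooth_gen_deriv(2)[OF smooth_gen_funpow_deriv[OF assms(1)]] field_differentiable_def
    by blast
  ultimately show ?thesis using assms(3,4) unfolding test_function_def by force
qed

text \<open>
  Testing the first weak derivative with \<open>deriv \<eta>\<close> is what leads to the second weak derivative.
\<close>

lemma test_function_deriv:
  assumes "test_function T \<eta>"
  shows "test_function T (deriv \<eta>)"
proof -
  have supp: "deriv \<eta> t = 0" if "t \<notin> closure {t. \<eta> t \<noteq> 0}" for t
  proof -
    have "(\<eta> has_field_derivative 0) (at t)"
      by (rule has_field_derivative_transform_within_open[of "\<lambda>_. 0" _ _ "- closure {t. \<eta> t \<noteq> 0}"])
         (use that closure_subset[of "{t. \<eta> t \<noteq> 0}"] in auto)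
    then show ?thesis by (rule DERIV_imp_deriv)
  qed
  then have "closure {t. deriv \<eta> t \<noteq> 0} \<subseteq> closure {t. \<eta> t \<noteq> 0}"
    by (intro closure_minimal) auto
  moreover have "(deriv ^^ k) (deriv \<eta>) field_differentiable (at x)" for k x
    using assms unfolding test_function_def by (metis funpow_Suc_right o_apply)
  ultimately show ?thesis using assms unfolding test_function_def by blast
qed

lemma test_function_continuous:
  assumes "test_function T \<eta>"
  shows "continuous_on S \<eta>"
proof -
  have "\<eta> field_differentiable (at x)" for x
    using assms unfolding test_function_def by (metis funpow_0)
  then show ?thesis
    by (meson field_differentiable_imp_continuous_at continuous_at_imp_continuous_on)
qed

text \<open>
  A smooth monotone transition from 0 on the negative axis to 1 beyond 1. Its rescaled derivatives are
  approximate identities supported to the right of their base point.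
\<close>

definition smooth_step :: "real \<Rightarrow> real" where
  "smooth_step x = flat 0 x * inverse (flat 0 x + flat 0 (1 - x))"

lemma smooth_step_denominator_pos: "flat 0 x + flat 0 (1 - x) > 0"
  by (auto simp: flat_def add_pos_pos)

lemma smooth_gen_smooth_step: "smooth_gen smooth_step"
proof -
  have "smooth_gen (\<lambda>x. flat 0 ((- 1) * x + 1))"
    by (intro smooth_gen.affine smooth_gen.flat)
  then have "smooth_gen (\<lambda>x. flat 0 (1 - x))" by simp
  then have "smooth_gen (\<lambda>x. flat 0 x * inverse (flat 0 x + flat 0 (1 - x)))"
    using smooth_step_denominator_pos
    by (intro smooth_gen.mult smooth_gen.flat smooth_gen.inverse smooth_gen.add)
       (auto simp: less_le)
  then show ?thesis by (simp add: smooth_step_def[abs_def])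
qed

lemma smooth_step_eq_0: "x \<le> 0 \<Longrightarrow> smooth_step x = 0"
  and smooth_step_eq_1: "x \<ge> 1 \<Longrightarrow> smooth_step x = 1"
  by (auto simp: smooth_step_def flat_def)

lemma smooth_step_range: "0 \<le> smooth_step x" "smooth_step x \<le> 1"
proof -
  have "flat 0 y \<ge> 0" for y by (simp add: flat_def)
  then have "0 \<le> flat 0 x" "0 \<le> flat 0 (1 - x)" by auto
  with smooth_step_denominator_pos[of x] show "0 \<le> smooth_step x" "smooth_step x \<le> 1"
    by (auto simp: smooth_step_def field_simps)
qed

lemma deriv_smooth_step_outside: "x \<notin> {0..1} \<Longrightarrow> deriv smooth_step x = 0"
proof -
  assume x: "x \<notin> {0..1}"
  have "(smooth_step has_field_derivative 0) (at x)"
  proof (cases "x < 0")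
    case True
    then show ?thesis
      by - (rule has_field_derivative_transform_within_open[of "\<lambda>_. 0" _ _ "{..<0}"],
            auto simp: smooth_step_eq_0)
  next
    case False
    with x show ?thesis
      by - (rule has_field_derivative_transform_within_open[of "\<lambda>_. 1" _ _ "{1<..}"],
            auto simp: smooth_step_eq_1)
  qed
  then show ?thesis by (rule DERIV_imp_deriv)
qed

lemma mono_smooth_step: "mono smooth_step"
proof (rule monoI)
  fix x y :: real
  assume "x \<le> y"
  have mono: "flat 0 a \<le> flat 0 b" if "a \<le> b" for a b
    using that by (auto simp: flat_def)
  have nonneg: "flat 0 a \<ge> 0" for a by (simp add: flat_def)
  have "flat 0 x * flat 0 (1 - y) \<le> flat 0 y * flat 0 (1 - x)"
    using \<open>x \<le> y\<close> by (intro mult_mono mono nonneg) auto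
  then show "smooth_step x \<le> smooth_step y"
    using smooth_step_denominator_pos[of x] smooth_step_denominator_pos[of y]
    by (simp add: smooth_step_def divide_simps flip: divide_inverse) (simp add: algebra_simps)
qed

lemma deriv_smooth_step_nonneg: "deriv smooth_step x \<ge> 0"
  by (rule mono_on_imp_deriv_nonneg[of UNIV smooth_step])
     (use mono_smooth_step smooth_gen_deriv(2)[OF smooth_gen_smooth_step] in auto)

section \<open>Weak derivatives of continuous functions\<close>

lemma smooth_gen_rescale:
  assumes "smooth_gen f"
  shows "smooth_gen (\<lambda>x. f ((x - c) / e))"
proof -
  have "smooth_gen (\<lambda>x. f ((1 / e) * x + (- c / e)))"
    by (rule smooth_gen.affine[OF assms])
  then show ?thesis by (simp add: diff_divide_distrib)
qed

lemma continuous_on_smooth_kernel: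
  "continuous_on S (\<lambda>x. deriv smooth_step ((x - c) / e) / e)"
proof (cases "e = 0")
  case False
  then show ?thesis
    by (intro continuous_on_divide continuous_on_const ballI
          smooth_gen_continuous[OF smooth_gen_rescale[OF smooth_gen_deriv(1)[OF smooth_gen_smooth_step]]])
qed simp

lemma continuous_integrable_open_interval:
  fixes h :: "real \<Rightarrow> real"
  assumes "continuous_on {0..T} h"
  shows "integrable (lebesgue_on {0<..<T}) h"
    and "integral\<^sup>L (lebesgue_on {0<..<T}) h = integral {0..T} h"
proof -
  have "h absolutely_integrable_on {0..T}"
    using assms by (rule absolutely_integrable_continuous_real)
  then have "set_integrable lebesgue {0<..<T} h"
    by (rule set_integrable_subset) auto
  then show int: "integrable (lebesgue_on {0<..<T}) h"
    by (simp add: integrable_restrict_space set_integrable_def)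
  show "integral\<^sup>L (lebesgue_on {0<..<T}) h = integral {0..T} h"
    using lebesgue_integral_eq_integral[OF int] by (simp add: integral_open_interval_real)
qed

lemma smooth_step_mass:
  assumes "\<epsilon> > 0" "0 \<le> \<sigma>" "\<sigma> + \<epsilon> \<le> T"
  shows "integral\<^sup>L (lebesgue_on {0<..<T}) (\<lambda>x. deriv smooth_step ((x - \<sigma>) / \<epsilon>) / \<epsilon>) = 1"
proof -
  have cont: "continuous_on {0..T} (\<lambda>x. deriv smooth_step ((x - \<sigma>) / \<epsilon>) / \<epsilon>)"
    by (rule continuous_on_smooth_kernel)
  have "((\<lambda>x. deriv smooth_step ((x - \<sigma>) / \<epsilon>) / \<epsilon>) has_integral
          smooth_step ((T - \<sigma>) / \<epsilon>) - smooth_step ((0 - \<sigma>) / \<epsilon>)) {0..T}"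
  proof (rule fundamental_theorem_of_calculus)
    show "0 \<le> T" using assms by simp
    fix x
    have "((\<lambda>x. (x - \<sigma>) / \<epsilon>) has_field_derivative 1 / \<epsilon>) (at x)"
      using assms by (auto intro!: derivative_eq_intros)
    from DERIV_chain2[OF smooth_gen_deriv(2)[OF smooth_gen_smooth_step] this]
    have "((\<lambda>x. smooth_step ((x - \<sigma>) / \<epsilon>)) has_field_derivative
            deriv smooth_step ((x - \<sigma>) / \<epsilon>) / \<epsilon>) (at x)" by simp
    then show "((\<lambda>x. smooth_step ((x - \<sigma>) / \<epsilon>)) has_vector_derivative
            deriv smooth_step ((x - \<sigma>) / \<epsilon>) / \<epsilon>) (at x within {0..T})"
      by (simp add: has_real_derivative_iff_has_vector_derivative[symmetric]
            has_field_derivative_at_within)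
  qed
  moreover have "smooth_step ((T - \<sigma>) / \<epsilon>) = 1" "smooth_step ((0 - \<sigma>) / \<epsilon>) = 0"
    using assms by (auto intro!: smooth_step_eq_0 smooth_step_eq_1 simp: field_simps)
  ultimately show ?thesis
    unfolding continuous_integrable_open_interval(2)[OF cont] by (metis diff_zero integral_unique)
qed

text \<open>
  The kernels may be centred at moving points \<open>\<sigma> n\<close>, so that their supports stay inside \<open>{0..T}\<close>
  even when the limit point \<open>s\<close> is an end point of this interval. This gives increments of the
  function up to the boundary without a separate continuity argument.
\<close>

lemma smooth_step_averages_tendsto:
  fixes w :: "real \<Rightarrow> real"
  assumes w: "continuous_on {0..T} w" and s: "s \<in> {0..T}"
    and \<epsilon>: "\<And>n. \<epsilon> n > 0" "\<epsilon> \<longlonglongrightarrow> 0"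
    and \<sigma>: "\<And>n. 0 \<le> \<sigma> n" "\<And>n. \<sigma> n + \<epsilon> n \<le> T" "\<sigma> \<longlonglongrightarrow> s"
  shows "(\<lambda>n. integral\<^sup>L (lebesgue_on {0<..<T})
            (\<lambda>x. deriv smooth_step ((x - \<sigma> n) / \<epsilon> n) / \<epsilon> n * w x)) \<longlonglongrightarrow> w s"
proof (rule LIMSEQ_I)
  fix r :: real
  assume "r > 0"
  define k where "k = (\<lambda>n x. deriv smooth_step ((x - \<sigma> n) / \<epsilon> n) / \<epsilon> n)"
  have contk: "continuous_on S (k n)" for S n
    unfolding k_def by (rule continuous_on_smooth_kernel)
  note int = continuous_integrable_open_interval(1)
  obtain d where d: "d > 0" "\<And>x. x \<in> {0..T} \<Longrightarrow> \<bar>x - s\<bar> < d \<Longrightarrow> \<bar>w x - w s\<bar> < r / 2"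
    using w s \<open>r > 0\<close> unfolding continuous_on_iff dist_real_def by (metis half_gt_zero)
  have "\<forall>\<^sub>F n in sequentially. \<bar>\<sigma> n - s\<bar> < d / 2"
    using \<sigma>(3) d(1) unfolding tendsto_iff dist_real_def by (metis half_gt_zero)
  moreover have "\<forall>\<^sub>F n in sequentially. \<bar>\<epsilon> n - 0\<bar> < d / 2"
    using \<epsilon>(2) d(1) unfolding tendsto_iff dist_real_def by (metis half_gt_zero)
  ultimately have "\<forall>\<^sub>F n in sequentially.
      norm (integral\<^sup>L (lebesgue_on {0<..<T}) (\<lambda>x. k n x * w x) - w s) < r"
  proof eventually_elim
    case (elim n)
    have mass: "integral\<^sup>L (lebesgue_on {0<..<T}) (k n) = 1"
      unfolding k_def using \<epsilon>(1) \<sigma>(1,2) by (intro smooth_step_mass)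
    have nonneg: "k n x \<ge> 0" for x
      unfolding k_def using deriv_smooth_step_nonneg \<epsilon>(1)[of n] by (simp add: less_imp_le)
    have bd: "norm (k n x * (w x - w s)) \<le> k n x * (r / 2)" if x: "x \<in> {0<..<T}" for x
    proof (cases "(x - \<sigma> n) / \<epsilon> n \<in> {0..1}")
      case True
      then have "\<sigma> n \<le> x" "x \<le> \<sigma> n + \<epsilon> n" using \<epsilon>(1)[of n] by (auto simp: field_simps)
      with elim have "\<bar>x - s\<bar> < d" by linarith
      with d(2)[of x] x have "\<bar>w x - w s\<bar> \<le> r / 2" by fastforce
      then show ?thesis
        using nonneg[of x] by (simp only: real_norm_def abs_mult abs_of_nonneg mult_left_mono)
    next
      case False
      then show ?thesis by (simp add: k_def deriv_smooth_step_outside)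
    qed
    have "integral\<^sup>L (lebesgue_on {0<..<T}) (\<lambda>x. k n x * w x) - w s
        = integral\<^sup>L (lebesgue_on {0<..<T}) (\<lambda>x. k n x * w x)
          - integral\<^sup>L (lebesgue_on {0<..<T}) (\<lambda>x. k n x * w s)"
      using mass by simp
    also have "\<dots> = integral\<^sup>L (lebesgue_on {0<..<T}) (\<lambda>x. k n x * w x - k n x * w s)"
      by (rule Bochner_Integration.integral_diff[symmetric])
         (intro int continuous_intros w contk)+
    also have "\<dots> = integral\<^sup>L (lebesgue_on {0<..<T}) (\<lambda>x. k n x * (w x - w s))"
      by (simp add: algebra_simps)
    finally have "norm (integral\<^sup>L (lebesgue_on {0<..<T}) (\<lambda>x. k n x * w x) - w s)
        = norm (integral\<^sup>L (lebesgue_on {0<..<T}) (\<lambda>x. k n x * (w x - w s)))" by simp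
    also have "\<dots> \<le> integral\<^sup>L (lebesgue_on {0<..<T}) (\<lambda>x. k n x * (r / 2))"
      by (rule Bochner_Integration.integral_norm_bound_integral)
         (use bd in \<open>auto intro!: int continuous_intros w contk\<close>)
    also have "\<dots> = r / 2" using mass by simp
    finally show ?case using \<open>r > 0\<close> by simp
  qed
  then show "\<exists>no. \<forall>n\<ge>no. norm (integral\<^sup>L (lebesgue_on {0<..<T})
      (\<lambda>x. deriv smooth_step ((x - \<sigma> n) / \<epsilon> n) / \<epsilon> n * w x) - w s) < r"
    by (simp add: k_def eventually_sequentially)
qed

text \<open>
  Test with smooth approximations \<open>\<eta> n\<close> of the indicator function of \<open>{s<..<t}\<close> that rise from 0 to 1 just
  after \<open>s\<close> and fall back just before \<open>t\<close>. Their derivatives average \<open>w\<close> near \<open>s\<close> and, with the opposite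
  sign, near \<open>t\<close>, while the right-hand side converges by dominated convergence.
\<close>

lemma weak_derivative_increment:
  fixes w g :: "real \<Rightarrow> real"
  assumes w: "continuous_on {0..T} w" and g: "integrable (lebesgue_on {0<..<T}) g"
    and weak: "\<And>\<eta>. test_function T \<eta> \<Longrightarrow>
       integral\<^sup>L (lebesgue_on {0<..<T}) (\<lambda>x. deriv \<eta> x * w x) =
       - integral\<^sup>L (lebesgue_on {0<..<T}) (\<lambda>x. \<eta> x * g x)"
    and st: "0 \<le> s" "s < t" "t \<le> T"
  shows "w t - w s = integral\<^sup>L (lebesgue_on {0<..<T}) (\<lambda>x. indicat_real {s<..<t} x * g x)"
proof -
  \<comment> \<open>The rise occupies \<open>[s + \<epsilon>, s + 2\<epsilon>]\<close> and the fall \<open>[t - 2\<epsilon>, t - \<epsilon>]\<close>; with \<open>4\<epsilon> \<le> t - s\<close> they do not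
    overlap.\<close>
  define \<epsilon> where "\<epsilon> = (\<lambda>n. (t - s) / (real n + 4))"
  have \<epsilon>_pos: "\<epsilon> n > 0" for n using st by (simp add: \<epsilon>_def)
  have \<epsilon>_le: "4 * \<epsilon> n \<le> t - s" for n
  proof -
    have "\<epsilon> n \<le> (t - s) / 4"
      unfolding \<epsilon>_def using st by (intro divide_left_mono) auto
    then show ?thesis by simp
  qed
  have \<epsilon>_lim: "\<epsilon> \<longlonglongrightarrow> 0"
    unfolding \<epsilon>_def
    by (intro tendsto_divide_0[OF tendsto_const] filterlim_at_top_imp_at_infinity
          filterlim_tendsto_add_at_top[OF _ filterlim_real_sequentially, of "\<lambda>_. 4" 4, simplified add.commute])
       (auto simp: add.commute)
  define \<sigma> \<tau> where "\<sigma> = (\<lambda>n. s + \<epsilon> n)" and "\<tau> = (\<lambda>n. t - 2 * \<epsilon> n)"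
  have lims: "\<sigma> \<longlonglongrightarrow> s" "\<tau> \<longlonglongrightarrow> t"
    unfolding \<sigma>_def \<tau>_def by (auto intro!: tendsto_eq_intros \<epsilon>_lim)
  define \<eta> where
    "\<eta> = (\<lambda>n x. smooth_step ((x - \<sigma> n) / \<epsilon> n) - smooth_step ((x - \<tau> n) / \<epsilon> n))"
  have smooth: "smooth_gen (\<eta> n)" for n
  proof -
    have "smooth_gen (\<lambda>x. smooth_step ((x - \<sigma> n) / \<epsilon> n)
            + (- 1) * smooth_step ((x - \<tau> n) / \<epsilon> n))"
      by (intro smooth_gen.add smooth_gen_cmult smooth_gen_rescale smooth_gen_smooth_step)
    then show ?thesis by (simp add: \<eta>_def)
  qed
  have outside: "\<eta> n x = 0" if "x \<notin> {s + \<epsilon> n..t - \<epsilon> n}" for n x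
  proof -
    from that consider "x < s + \<epsilon> n" | "x > t - \<epsilon> n" by fastforce
    then show ?thesis
    proof cases
      case 1
      then have "(x - \<sigma> n) / \<epsilon> n \<le> 0" "(x - \<tau> n) / \<epsilon> n \<le> 0"
        using \<epsilon>_pos[of n] \<epsilon>_le[of n] by (auto simp: \<sigma>_def \<tau>_def divide_simps)
      then show ?thesis by (simp add: \<eta>_def smooth_step_eq_0)
    next
      case 2
      then have "(x - \<sigma> n) / \<epsilon> n \<ge> 1" "(x - \<tau> n) / \<epsilon> n \<ge> 1"
        using \<epsilon>_pos[of n] \<epsilon>_le[of n] by (auto simp: \<sigma>_def \<tau>_def divide_simps)
      then show ?thesis by (simp add: \<eta>_def smooth_step_eq_1)
    qed
  qed
  have test: "test_function T (\<eta> n)" for n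
    by (rule test_functionI[of _ "s + \<epsilon> n" "t - \<epsilon> n"])
       (use smooth outside \<epsilon>_pos[of n] st in auto)
  have deriv_\<eta>: "deriv (\<eta> n) x = deriv smooth_step ((x - \<sigma> n) / \<epsilon> n) / \<epsilon> n
                             - deriv smooth_step ((x - \<tau> n) / \<epsilon> n) / \<epsilon> n" for n x
  proof -
    have "((\<lambda>x. smooth_step ((x - c) / \<epsilon> n)) has_field_derivative
            deriv smooth_step ((x - c) / \<epsilon> n) / \<epsilon> n) (at x)" for c
    proof -
      have "((\<lambda>x. (x - c) / \<epsilon> n) has_field_derivative 1 / \<epsilon> n) (at x)"
        using \<epsilon>_pos[of n] by (auto intro!: derivative_eq_intros)
      from DERIV_chain2[OF smooth_gen_deriv(2)[OF smooth_gen_smooth_step] this]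
      show ?thesis by simp
    qed
    then show ?thesis unfolding \<eta>_def by (intro DERIV_imp_deriv DERIV_diff)
  qed
  let ?k = "\<lambda>\<rho> n x. deriv smooth_step ((x - \<rho> n) / \<epsilon> n) / \<epsilon> n * w x"
  have int_k: "integrable (lebesgue_on {0<..<T}) (?k \<rho> n)" for \<rho> n
    by (intro continuous_integrable_open_interval(1) continuous_on_mult w
              continuous_on_smooth_kernel)
  have "(\<lambda>n. integral\<^sup>L (lebesgue_on {0<..<T}) (?k \<sigma> n)) \<longlonglongrightarrow> w s"
    by (rule smooth_step_averages_tendsto[OF w])
       (use st lims \<epsilon>_lim \<epsilon>_pos in \<open>auto simp: \<sigma>_def intro: add_nonneg_nonneg less_imp_le\<close>,
        use \<epsilon>_le \<epsilon>_pos st in \<open>smt (verit)\<close>)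
  moreover have "(\<lambda>n. integral\<^sup>L (lebesgue_on {0<..<T}) (?k \<tau> n)) \<longlonglongrightarrow> w t"
    by (rule smooth_step_averages_tendsto[OF w])
       (use st lims \<epsilon>_lim \<epsilon>_pos in \<open>auto simp: \<tau>_def\<close>, (use \<epsilon>_le \<epsilon>_pos st in \<open>smt (verit)\<close>)+)
  ultimately have "(\<lambda>n. integral\<^sup>L (lebesgue_on {0<..<T}) (?k \<sigma> n)
        - integral\<^sup>L (lebesgue_on {0<..<T}) (?k \<tau> n)) \<longlonglongrightarrow> w s - w t"
    by (rule tendsto_diff)
  moreover have "integral\<^sup>L (lebesgue_on {0<..<T}) (?k \<sigma> n)
        - integral\<^sup>L (lebesgue_on {0<..<T}) (?k \<tau> n)
      = - integral\<^sup>L (lebesgue_on {0<..<T}) (\<lambda>x. \<eta> n x * g x)" for n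
  proof -
    have "integral\<^sup>L (lebesgue_on {0<..<T}) (?k \<sigma> n)
        - integral\<^sup>L (lebesgue_on {0<..<T}) (?k \<tau> n)
      = integral\<^sup>L (lebesgue_on {0<..<T}) (\<lambda>x. ?k \<sigma> n x - ?k \<tau> n x)"
      by (rule Bochner_Integration.integral_diff[symmetric, OF int_k int_k])
    also have "(\<lambda>x. ?k \<sigma> n x - ?k \<tau> n x) = (\<lambda>x. deriv (\<eta> n) x * w x)"
      by (simp add: deriv_\<eta> algebra_simps)
    finally show ?thesis using weak[OF test] by simp
  qed
  ultimately have lim1: "(\<lambda>n. - integral\<^sup>L (lebesgue_on {0<..<T}) (\<lambda>x. \<eta> n x * g x))
      \<longlonglongrightarrow> w s - w t" by simp
  have "(\<lambda>n. integral\<^sup>L (lebesgue_on {0<..<T}) (\<lambda>x. \<eta> n x * g x))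
      \<longlonglongrightarrow> integral\<^sup>L (lebesgue_on {0<..<T}) (\<lambda>x. indicat_real {s<..<t} x * g x)"
  proof (rule integral_dominated_convergence[where w = "\<lambda>x. norm (g x)"])
    have "\<eta> n \<in> borel_measurable (lebesgue_on {0<..<T})" for n
      by (intro continuous_imp_measurable_on_sets_lebesgue smooth_gen_continuous smooth) auto
    then show "(\<lambda>x. \<eta> n x * g x) \<in> borel_measurable (lebesgue_on {0<..<T})" for n
      using borel_measurable_integrable[OF g] by (intro borel_measurable_times)
    have "indicat_real {s<..<t} \<in> borel_measurable (lebesgue_on {0<..<T})"
      by (rule measurable_restrict_space1, rule borel_measurable_indicator) auto
    then show "(\<lambda>x. indicat_real {s<..<t} x * g x) \<in> borel_measurable (lebesgue_on {0<..<T})"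
      using borel_measurable_integrable[OF g] by (intro borel_measurable_times)
    show "integrable (lebesgue_on {0<..<T}) (\<lambda>x. norm (g x))"
      using g by (rule integrable_norm)
    have "\<bar>\<eta> n x\<bar> \<le> 1" for n x
      unfolding \<eta>_def using smooth_step_range by (smt (verit))
    then show "AE x in lebesgue_on {0<..<T}. norm (\<eta> n x * g x) \<le> norm (g x)" for n
      by (intro AE_I2) (auto simp: abs_mult intro: mult_left_le_one_le)
    have "(\<lambda>n. \<eta> n x) \<longlonglongrightarrow> indicat_real {s<..<t} x" for x
    proof (cases "x \<in> {s<..<t}")
      case True
      have "(\<lambda>n. s + 2 * \<epsilon> n) \<longlonglongrightarrow> s" by (auto intro!: tendsto_eq_intros \<epsilon>_lim)
      then have "\<forall>\<^sub>F n in sequentially. s + 2 * \<epsilon> n < x"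
        using True by (intro order_tendstoD(2)) auto
      moreover have "\<forall>\<^sub>F n in sequentially. \<tau> n > x"
        using True by (intro order_tendstoD(1)[OF lims(2)]) auto
      ultimately have "\<forall>\<^sub>F n in sequentially. 1 = \<eta> n x"
      proof eventually_elim
        case (elim n)
        then have "(x - \<sigma> n) / \<epsilon> n \<ge> 1" "(x - \<tau> n) / \<epsilon> n \<le> 0"
          using \<epsilon>_pos[of n] by (auto simp: \<sigma>_def divide_simps)
        then show ?case by (simp add: \<eta>_def smooth_step_eq_1 smooth_step_eq_0)
      qed
      then have "(\<lambda>n. \<eta> n x) \<longlonglongrightarrow> 1" by (rule Lim_transform_eventually[OF tendsto_const])
      with True show ?thesis by simp
    next
      case False
      then have "\<eta> n x = 0" for n using \<epsilon>_pos[of n] by (intro outside) auto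
      with False show ?thesis by simp
    qed
    then show "AE x in lebesgue_on {0<..<T}. (\<lambda>n. \<eta> n x * g x) \<longlonglongrightarrow> indicat_real {s<..<t} x * g x"
      by (intro AE_I2 tendsto_mult tendsto_const)
  qed
  from LIMSEQ_unique[OF lim1 tendsto_minus[OF this]] show ?thesis by simp
qed

text \<open>
  The set where the two functions differ is open, and an open null set is empty.
\<close>

lemma continuous_AE_eq_imp_eq:
  fixes h1 h2 :: "real \<Rightarrow> 'a::real_normed_vector"
  assumes "continuous_on {0..T} h1" "continuous_on {0..T} h2" "T > 0"
    and ae: "AE t in lebesgue_on {0<..<T}. h1 t = h2 t"
    and t: "t \<in> {0..T}"
  shows "h1 t = h2 t"
proof -
  define N where "N = {0<..<T} \<inter> {t. h1 t - h2 t \<in> - {0}}"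
  have cont: "continuous_on {0..T} (\<lambda>t. h1 t - h2 t)"
    using assms by (intro continuous_intros)
  have "open ({0<..<T} \<inter> (\<lambda>t. h1 t - h2 t) -` (- {0}))"
    by (rule continuous_open_preimage) (auto intro: continuous_on_subset[OF cont])
  then have "open N" by (simp add: N_def vimage_def)
  have "AE t in lebesgue. t \<in> {0<..<T} \<longrightarrow> h1 t = h2 t"
    using ae by (subst (asm) AE_restrict_space_iff) auto
  then have "AE t in lebesgue. t \<notin> N"
    by eventually_elim (auto simp: N_def)
  then have "N \<in> null_sets lebesgue"
    using \<open>open N\<close> by (subst (asm) AE_iff_null_sets[symmetric]) (auto intro: borel_open)
  then have "negligible N" by (simp add: negligible_iff_null_sets)
  with \<open>open N\<close> have "N = {}" using open_not_negligible by blast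
  then have "h1 x - h2 x = 0" if "x \<in> {0<..<T}" for x
    using that unfolding N_def by blast
  then have "h1 t - h2 t = 0"
    using t \<open>T > 0\<close> cont
    by - (rule continuous_constant_on_closure[of "{0<..<T}" "\<lambda>t. h1 t - h2 t"], auto)
  then show ?thesis by simp
qed

lemma in_L2_integrable:
  fixes w :: "real \<Rightarrow> 'a::{banach,second_countable_topology}"
  assumes "in_L2 T w"
  shows "integrable (lebesgue_on {0<..<T}) w"
proof (rule Bochner_Integration.integrable_bound)
  have "integrable (lebesgue_on {0<..<T}) (\<lambda>t. 1::real)"
    by (rule continuous_integrable_open_interval) auto
  then show "integrable (lebesgue_on {0<..<T}) (\<lambda>t. 1 + (norm (w t))\<^sup>2)"
    using assms unfolding in_L2_def by (intro Bochner_Integration.integrable_add) auto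
  show "w \<in> borel_measurable (lebesgue_on {0<..<T})"
    using assms unfolding in_L2_def by blast
  have "x \<le> 1 + x\<^sup>2" for x :: real
    using zero_le_power2[of "x - 1"] zero_le_power2[of "x + 1"]
    by (simp add: power2_eq_square algebra_simps)
  then show "AE t in lebesgue_on {0<..<T}. norm (w t) \<le> norm (1 + (norm (w t))\<^sup>2)"
    by (intro AE_I2) (smt (verit) real_norm_def)
qed

lemma integrable_continuous_scaleR:
  fixes w :: "real \<Rightarrow> 'a::{banach,second_countable_topology}"
  assumes w: "integrable (lebesgue_on {0<..<T}) w" and \<eta>: "continuous_on {0..T} (\<eta> :: real \<Rightarrow> real)"
  shows "integrable (lebesgue_on {0<..<T}) (\<lambda>t. \<eta> t *\<^sub>R w t)"
proof -
  have "compact (\<eta> ` {0..T})"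
    by (rule compact_continuous_image[OF \<eta>]) auto
  then obtain M where M: "\<And>t. t \<in> {0..T} \<Longrightarrow> norm (\<eta> t) \<le> M"
    using compact_imp_bounded bounded_iff by (metis imageI)
  have [measurable]: "\<eta> \<in> borel_measurable (lebesgue_on {0<..<T})"
    by (intro continuous_imp_measurable_on_sets_lebesgue continuous_on_subset[OF \<eta>]) auto
  note [measurable] = borel_measurable_integrable[OF w]
  show ?thesis
  proof (rule Bochner_Integration.integrable_bound)
    show "integrable (lebesgue_on {0<..<T}) (\<lambda>t. M * norm (w t))"
      using w by (intro integrable_mult_right integrable_norm)
    show "(\<lambda>t. \<eta> t *\<^sub>R w t) \<in> borel_measurable (lebesgue_on {0<..<T})" by measurable
    have "norm (\<eta> t *\<^sub>R w t) \<le> norm (M * norm (w t))" if "t \<in> {0<..<T}" for t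
    proof -
      have "\<bar>\<eta> t\<bar> \<le> \<bar>M\<bar>" using M[of t] that by simp
      then show ?thesis by (simp add: abs_mult mult_right_mono)
    qed
    then show "AE t in lebesgue_on {0<..<T}. norm (\<eta> t *\<^sub>R w t) \<le> norm (M * norm (w t))"
      by (intro AE_I2) auto
  qed
qed

text \<open>
  Pairing with a fixed vector turns weak derivatives in \<open>H\<close> into scalar ones; integrability of the
  products is needed to take the inner product out of the Bochner integral.
\<close>

lemma weak_derivative_inner:
  fixes w g :: "real \<Rightarrow> 'a::{real_inner,banach,second_countable_topology}"
  assumes weak: "weak_derivative T w g" and w: "in_L2 T w" and g: "in_L2 T g"
    and \<eta>: "test_function T \<eta>"
  shows "integral\<^sup>L (lebesgue_on {0<..<T}) (\<lambda>t. deriv \<eta> t * inner (w t) h) =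
       - integral\<^sup>L (lebesgue_on {0<..<T}) (\<lambda>t. \<eta> t * inner (g t) h)"
proof -
  have "integral\<^sup>L (lebesgue_on {0<..<T}) (\<lambda>t. deriv \<eta> t * inner (w t) h)
      = inner (integral\<^sup>L (lebesgue_on {0<..<T}) (\<lambda>t. deriv \<eta> t *\<^sub>R w t)) h"
    using integrable_continuous_scaleR[OF in_L2_integrable[OF w]
            test_function_continuous[OF test_function_deriv[OF \<eta>]]]
    by (subst integral_inner_left[symmetric]) auto
  also have "\<dots> = - inner (integral\<^sup>L (lebesgue_on {0<..<T}) (\<lambda>t. \<eta> t *\<^sub>R g t)) h"
    using weak \<eta> unfolding weak_derivative_def by simp
  also have "inner (integral\<^sup>L (lebesgue_on {0<..<T}) (\<lambda>t. \<eta> t *\<^sub>R g t)) h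
      = integral\<^sup>L (lebesgue_on {0<..<T}) (\<lambda>t. \<eta> t * inner (g t) h)"
    using integrable_continuous_scaleR[OF in_L2_integrable[OF g] test_function_continuous[OF \<eta>]]
    by (subst integral_inner_left[symmetric]) auto
  finally show ?thesis .
qed

section \<open>Consistency of difference quotients of the solution\<close>

definition weak_second_derivative ::
    "real \<Rightarrow> (real \<Rightarrow> 'h::{banach,second_countable_topology}) \<Rightarrow> (real \<Rightarrow> 'h) \<Rightarrow> bool" where
  "weak_second_derivative T w g \<longleftrightarrow>
     in_L2 T w \<and> in_L2 T g \<and>
     (\<exists>w'. in_L2 T w' \<and> weak_derivative T w w' \<and> weak_derivative T w' g)"

text \<open>
  For an integrable derivative \<open>g\<close>, the variation on the interval from \<open>s\<close> to \<open>t\<close> of its primitive.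
\<close>

definition total_variation ::
    "real \<Rightarrow> (real \<Rightarrow> 'h::real_normed_vector) \<Rightarrow> real \<Rightarrow> real \<Rightarrow> real" where
  "total_variation T g s t =
     integral\<^sup>L (lebesgue_on {0<..<T}) (\<lambda>x. indicat_real {s<..<t} x * norm (g x))"

lemma indicator_measurable_open_interval [measurable]:
  fixes s t T :: real
  shows "indicat_real {s<..<t} \<in> borel_measurable (lebesgue_on {0<..<T})"
  by (rule measurable_restrict_space1, rule borel_measurable_indicator)
     (auto intro: fmeasurableD)

lemma integrable_indicator_mult:
  fixes h :: "real \<Rightarrow> real"
  assumes "integrable (lebesgue_on {0<..<T}) h"
  shows "integrable (lebesgue_on {0<..<T}) (\<lambda>x. indicat_real {s<..<t} x * h x)"
proof (rule Bochner_Integration.integrable_bound[OF assms])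
  note [measurable] = borel_measurable_integrable[OF assms]
  show "(\<lambda>x. indicat_real {s<..<t} x * h x) \<in> borel_measurable (lebesgue_on {0<..<T})" by measurable
qed (auto simp: indicator_def)

lemma integral_indicator_open_interval:
  assumes "0 \<le> s" "s \<le> t" "t \<le> T"
  shows "integral\<^sup>L (lebesgue_on {0<..<T}) (indicat_real {s<..<t}) = t - s"
proof -
  have "measure (lebesgue_on {0<..<T}) {s<..<t} = measure lebesgue {s<..<t}"
    by (rule measure_restrict_space) (use assms in auto)
  then show ?thesis using assms
    by (subst Bochner_Integration.integral_indicator) (auto simp: Int_absorb2 space_restrict_space subset_eq)
qed

lemma total_variation_mono:
  fixes g :: "real \<Rightarrow> 'h::{banach,second_countable_topology}"
  assumes "integrable (lebesgue_on {0<..<T}) g" "s \<le> s'" "t' \<le> t"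
  shows "total_variation T g s' t' \<le> total_variation T g s t"
  unfolding total_variation_def
  by (rule integral_mono)
     (use assms(2,3) in \<open>auto intro!: integrable_indicator_mult integrable_norm assms(1)
        mult_right_mono split: split_indicator\<close>)

text \<open>
  The Cauchy-Schwarz inequality, obtained by integrating \<open>(norm (g x) - c)\<^sup>2 \<ge> 0\<close> with \<open>c\<close> the mean of
  \<open>norm (g x)\<close> over the interval.
\<close>

lemma total_variation_square_le:
  fixes g :: "real \<Rightarrow> 'h::{banach,second_countable_topology}"
  assumes g: "in_L2 T g" and st: "0 \<le> s" "s < t" "t \<le> T"
  shows "(total_variation T g s t)\<^sup>2 \<le>
    (t - s) * integral\<^sup>L (lebesgue_on {0<..<T}) (\<lambda>x. indicat_real {s<..<t} x * (norm (g x))\<^sup>2)"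
proof -
  define e where "e = total_variation T g s t"
  define c where "c = e / (t - s)"
  define J where "J = integral\<^sup>L (lebesgue_on {0<..<T}) (\<lambda>x. indicat_real {s<..<t} x * (norm (g x))\<^sup>2)"
  have int1: "integrable (lebesgue_on {0<..<T}) (\<lambda>x. indicat_real {s<..<t} x * norm (g x))"
    using in_L2_integrable[OF g] by (intro integrable_indicator_mult integrable_norm)
  have int2: "integrable (lebesgue_on {0<..<T}) (\<lambda>x. indicat_real {s<..<t} x * (norm (g x))\<^sup>2)"
    using g unfolding in_L2_def by (intro integrable_indicator_mult) auto
  have "integrable (lebesgue_on {0<..<T}) (\<lambda>x. indicat_real {s<..<t} x * 1)"
    by (intro integrable_indicator_mult continuous_integrable_open_interval) auto
  then have int0: "integrable (lebesgue_on {0<..<T}) (\<lambda>x. indicat_real {s<..<t} x)" by simp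
  have "0 \<le> integral\<^sup>L (lebesgue_on {0<..<T}) (\<lambda>x. indicat_real {s<..<t} x * (norm (g x) - c)\<^sup>2)"
    by (rule Bochner_Integration.integral_nonneg) auto
  also have "(\<lambda>x. indicat_real {s<..<t} x * (norm (g x) - c)\<^sup>2) =
      (\<lambda>x. indicat_real {s<..<t} x * (norm (g x))\<^sup>2
            - (2 * c) * (indicat_real {s<..<t} x * norm (g x)) + c\<^sup>2 * indicat_real {s<..<t} x)"
    by (auto simp: fun_eq_iff power2_eq_square algebra_simps)
  also have "integral\<^sup>L (lebesgue_on {0<..<T}) \<dots> = J - 2 * c * e + c\<^sup>2 * (t - s)"
    using int0 int1 int2 integral_indicator_open_interval[of s t T] st
    by (simp add: J_def e_def total_variation_def)
  also have "\<dots> = J - e\<^sup>2 / (t - s)"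
  proof -
    have "e = c * (t - s)" using st by (simp add: c_def)
    then show ?thesis using st by (simp add: power2_eq_square)
  qed
  finally show ?thesis
    using st unfolding J_def[symmetric] e_def[symmetric] by (simp add: field_simps)
qed

lemma time_node_simps:
  assumes "m \<ge> 1" "k \<ge> 1"
  shows "time_node T m k - time_node T m (k - 1) = time_step T m"
  using assms by (auto simp: time_node_def of_nat_diff algebra_simps)

lemma time_node_bounds:
  assumes "T > 0" "m \<ge> 1" "k \<le> m"
  shows "0 \<le> time_node T m k" "time_node T m k \<le> T"
  using assms by (auto simp: time_node_def time_step_def field_simps)

lemma time_step_pos: "T > 0 \<Longrightarrow> m \<ge> 1 \<Longrightarrow> time_step T m > 0"
  by (simp add: time_step_def)

lemma time_node_mono: "T > 0 \<Longrightarrow> i \<le> j \<Longrightarrow> time_node T m i \<le> time_node T m j"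
  by (simp add: time_node_def time_step_def mult_right_mono divide_right_mono)

text \<open>
  The time intervals are disjoint, so the integrals of \<open>(norm (g x))\<^sup>2\<close> over them add up to at most the integral over
  the whole of \<open>{0<..<T}\<close>.
\<close>

lemma sum_total_variation_square_le:
  fixes g :: "real \<Rightarrow> 'h::{banach,second_countable_topology}"
  assumes g: "in_L2 T g" and T: "T > 0" and m: "m \<ge> 1"
  shows "(\<Sum>k=1..m. (total_variation T g (time_node T m (k - 1)) (time_node T m k))\<^sup>2)
    \<le> time_step T m * integral\<^sup>L (lebesgue_on {0<..<T}) (\<lambda>x. (norm (g x))\<^sup>2)"
proof -
  define I where "I = (\<lambda>k. {time_node T m (k - 1)<..<time_node T m k})"
  have g2: "integrable (lebesgue_on {0<..<T}) (\<lambda>x. (norm (g x))\<^sup>2)"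
    using g unfolding in_L2_def by blast
  have disj: "(\<Sum>k=1..m. indicat_real (I k) x) \<le> 1" for x
  proof (cases "\<exists>k\<in>{1..m}. x \<in> I k")
    case True
    then obtain k where k: "k \<in> {1..m}" "x \<in> I k" by blast
    have "x \<notin> I j" if "j \<in> {1..m} - {k}" for j
    proof -
      from that k have "j \<le> k - 1 \<or> k \<le> j - 1" by auto
      then have "time_node T m j \<le> time_node T m (k - 1) \<or> time_node T m k \<le> time_node T m (j - 1)"
        using time_node_mono[OF T] by blast
      with k show ?thesis by (auto simp: I_def)
    qed
    then have "(\<Sum>k=1..m. indicat_real (I k) x) = indicat_real (I k) x"
      using k by (subst sum.remove[of _ k]) auto
    then show ?thesis by (simp add: indicator_def)
  next
    case False
    then show ?thesis by (auto simp: sum.neutral)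
  qed
  have int: "integrable (lebesgue_on {0<..<T}) (\<lambda>x. indicat_real (I k) x * (norm (g x))\<^sup>2)" for k
    unfolding I_def by (rule integrable_indicator_mult[OF g2])
  have "(\<Sum>k=1..m. (total_variation T g (time_node T m (k - 1)) (time_node T m k))\<^sup>2)
      \<le> (\<Sum>k=1..m. time_step T m * integral\<^sup>L (lebesgue_on {0<..<T}) (\<lambda>x. indicat_real (I k) x * (norm (g x))\<^sup>2))"
  proof (rule sum_mono)
    fix k assume k: "k \<in> {1..m}"
    then have step: "time_node T m k - time_node T m (k - 1) = time_step T m"
      using m by (intro time_node_simps) auto
    have "0 \<le> time_node T m (k - 1)" "time_node T m k \<le> T"
      using k by (auto intro!: time_node_bounds T m)
    with total_variation_square_le[OF g, of "time_node T m (k - 1)" "time_node T m k"]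
      step time_step_pos[OF T m]
    show "(total_variation T g (time_node T m (k - 1)) (time_node T m k))\<^sup>2
      \<le> time_step T m * integral\<^sup>L (lebesgue_on {0<..<T}) (\<lambda>x. indicat_real (I k) x * (norm (g x))\<^sup>2)"
      by (simp add: I_def)
  qed
  also have "\<dots> = time_step T m * integral\<^sup>L (lebesgue_on {0<..<T})
      (\<lambda>x. \<Sum>k=1..m. indicat_real (I k) x * (norm (g x))\<^sup>2)"
    by (subst Bochner_Integration.integral_sum) (rule int, simp only: sum_distrib_left)
  also have "\<dots> \<le> time_step T m * integral\<^sup>L (lebesgue_on {0<..<T}) (\<lambda>x. (norm (g x))\<^sup>2)"
  proof (intro mult_left_mono integral_mono Bochner_Integration.integrable_sum int g2)
    show "(\<Sum>k=1..m. indicat_real (I k) x * (norm (g x))\<^sup>2) \<le> (norm (g x))\<^sup>2" for x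
      using mult_right_mono[OF disj, of "(norm (g x))\<^sup>2" x] by (simp add: sum_distrib_right)
  qed (use time_step_pos[OF T m] in simp)
  finally show ?thesis .
qed

context parametrized_problem
begin

text \<open>
  The value at \<open>\<psi>\<close> of the time derivative of the solution, read off from the equation. In contrast to the
  weak derivative itself it is defined and continuous at every time of \<open>{0..T}\<close>.
\<close>

definition velocity :: "real \<Rightarrow> 'v \<Rightarrow> real \<Rightarrow> real" where
  "velocity \<mu> \<psi> t = inner (f t) (emb \<psi>) - a (u \<mu> t) \<psi> \<mu> - inner (F (u \<mu> t) \<mu>) (emb \<psi>)"

context
  fixes \<mu> :: real
  assumes \<mu>: "\<mu> \<in> P"
begin

lemma bilinear_a: "bilinear (\<lambda>v w. a v w \<mu>)"
  using \<mu> P_pos by (intro a_bilinear) auto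

lemma continuous_emb_u: "continuous_on {0..T} (\<lambda>t. emb (u \<mu> t))"
  using bounded_linear.continuous_on[OF emb_bounded_linear u_cont[OF \<mu>]] .

lemma continuous_velocity: "continuous_on {0..T} (velocity \<mu> \<psi>)"
proof -
  have "bounded_linear (\<lambda>v. a v \<psi> \<mu>)"
  proof (rule bounded_linear_intro[where K = "\<beta> \<mu> * norm \<psi>"])
    show "norm (a v \<psi> \<mu>) \<le> norm v * (\<beta> \<mu> * norm \<psi>)" for v
      using A1[OF \<mu>, of v \<psi>] by (simp add: mult_ac)
  qed (use bilinear_a in \<open>auto simp: bilinear_ladd[OF bilinear_a] bilinear_lmul[OF bilinear_a]\<close>)
  then have cont_a: "continuous_on {0..T} (\<lambda>t. a (u \<mu> t) \<psi> \<mu>)"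
    by (rule bounded_linear.continuous_on[OF _ u_cont[OF \<mu>]])
  have "continuous_on UNIV (\<lambda>v. F v \<mu>)"
    using F1[OF \<mu>] L\<^sub>F(2)[OF \<mu>]
    by (intro lipschitz_on_continuous_on[of "L\<^sub>F \<mu>"] lipschitz_onI) (auto simp: dist_norm)
  then have cont_F: "continuous_on {0..T} (\<lambda>t. F (u \<mu> t) \<mu>)"
    by (rule continuous_on_compose2[OF _ u_cont[OF \<mu>]]) auto
  show ?thesis
    unfolding velocity_def by (intro continuous_intros f_cont cont_a cont_F)
qed

lemma initial_value: "u \<mu> 0 = \<phi>"
proof -
  obtain wH where wH: "continuous_on {0..T} wH"
      "AE t in lebesgue_on {0<..<T}. wH t = emb (u \<mu> t)" "wH 0 = emb \<phi>"
    using u_solution[OF \<mu>] unfolding is_solution_def by blast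
  have "wH 0 = emb (u \<mu> 0)"
    by (rule continuous_AE_eq_imp_eq[OF wH(1) continuous_emb_u T_pos wH(2)]) (use T_pos in auto)
  with wH(3) show ?thesis using emb_inj by (simp add: inj_eq)
qed

text \<open>
  The derivative in \<open>V\<^sup>*\<close> and the velocity agree almost everywhere by the weak form of the equation.
\<close>

lemma solution_has_weak_derivative_velocity:
  assumes \<eta>: "test_function T \<eta>"
  shows "integral\<^sup>L (lebesgue_on {0<..<T}) (\<lambda>t. deriv \<eta> t * inner (emb (u \<mu> t)) (emb \<psi>)) =
       - integral\<^sup>L (lebesgue_on {0<..<T}) (\<lambda>t. \<eta> t * velocity \<mu> \<psi> t)"
proof -
  obtain g where g: "in_L2 T g" "dual_weak_derivative emb T (u \<mu>) g"
    "\<And>\<psi>. AE t in lebesgue_on {0<..<T}. blinfun_apply (g t) \<psi> + a (u \<mu> t) \<psi> \<mu>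
        + inner (F (u \<mu> t) \<mu>) (emb \<psi>) = inner (f t) (emb \<psi>)"
    using u_solution[OF \<mu>] unfolding is_solution_def by blast
  have [measurable]: "g \<in> borel_measurable (lebesgue_on {0<..<T})"
    using g(1) unfolding in_L2_def by blast
  have [measurable]: "(\<lambda>A. blinfun_apply A \<psi>) \<in> borel_measurable borel"
    by (intro borel_measurable_continuous_onI continuous_intros)
  have [measurable]: "(\<lambda>t. blinfun_apply (g t) \<psi>) \<in> borel_measurable (lebesgue_on {0<..<T})"
    by (rule measurable_compose[of g _ borel]) measurable
  have [measurable]: "\<eta> \<in> borel_measurable (lebesgue_on {0<..<T})"
    "velocity \<mu> \<psi> \<in> borel_measurable (lebesgue_on {0<..<T})"
    by (auto intro!: continuous_imp_measurable_on_sets_lebesgue test_function_continuous[OF \<eta>]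
          continuous_on_subset[OF continuous_velocity])
  have "integral\<^sup>L (lebesgue_on {0<..<T}) (\<lambda>t. \<eta> t * blinfun_apply (g t) \<psi>)
      = integral\<^sup>L (lebesgue_on {0<..<T}) (\<lambda>t. \<eta> t * velocity \<mu> \<psi> t)"
  proof (rule integral_cong_AE)
    show "AE t in lebesgue_on {0<..<T}. \<eta> t * blinfun_apply (g t) \<psi> = \<eta> t * velocity \<mu> \<psi> t"
      using g(3)[of \<psi>] by eventually_elim (auto simp: velocity_def)
  qed measurable
  with g(2) \<eta> show ?thesis unfolding dual_weak_derivative_def by simp
qed

context
  fixes g :: "real \<Rightarrow> 'h"
  assumes g: "weak_second_derivative T (\<lambda>t. emb (u \<mu> t)) g"
begin

text \<open>
  Both the velocity and the \<open>H\<close>-valued weak derivative \<open>w'\<close> of the solution, paired with \<open>\<psi>\<close>, are weak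
  derivatives of the same function. They therefore have equal integrals against the test function
  \<open>deriv \<eta>\<close>, and for \<open>w'\<close> this integral is known.
\<close>

lemma velocity_has_weak_derivative:
  assumes \<eta>: "test_function T \<eta>"
  shows "integral\<^sup>L (lebesgue_on {0<..<T}) (\<lambda>t. deriv \<eta> t * velocity \<mu> \<psi> t) =
       - integral\<^sup>L (lebesgue_on {0<..<T}) (\<lambda>t. \<eta> t * inner (g t) (emb \<psi>))"
proof -
  obtain w' where w': "in_L2 T w'" "weak_derivative T (\<lambda>t. emb (u \<mu> t)) w'" "weak_derivative T w' g"
    and L2: "in_L2 T (\<lambda>t. emb (u \<mu> t))" "in_L2 T g"
    using g unfolding weak_second_derivative_def by blast
  have "integral\<^sup>L (lebesgue_on {0<..<T}) (\<lambda>t. deriv \<eta> t * velocity \<mu> \<psi> t)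
      = integral\<^sup>L (lebesgue_on {0<..<T}) (\<lambda>t. deriv \<eta> t * inner (w' t) (emb \<psi>))"
    using solution_has_weak_derivative_velocity[OF test_function_deriv[OF \<eta>], of \<psi>]
      weak_derivative_inner[OF w'(2) L2(1) w'(1) test_function_deriv[OF \<eta>], of "emb \<psi>"] by simp
  also have "\<dots> = - integral\<^sup>L (lebesgue_on {0<..<T}) (\<lambda>t. \<eta> t * inner (g t) (emb \<psi>))"
    by (rule weak_derivative_inner[OF w'(3) w'(1) L2(2) \<eta>])
  finally show ?thesis .
qed

lemma velocity_increment_le:
  assumes st: "0 \<le> s" "s \<le> t" "t \<le> T"
  shows "\<bar>velocity \<mu> \<psi> t - velocity \<mu> \<psi> s\<bar> \<le> norm (emb \<psi>) * total_variation T g s t"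
proof (cases "s = t")
  case True
  then show ?thesis by (simp add: total_variation_def)
next
  case False
  have int_g: "integrable (lebesgue_on {0<..<T}) g"
    using g unfolding weak_second_derivative_def by (auto intro: in_L2_integrable)
  then have int: "integrable (lebesgue_on {0<..<T}) (\<lambda>x. inner (g x) (emb \<psi>))" by simp
  have "velocity \<mu> \<psi> t - velocity \<mu> \<psi> s
      = integral\<^sup>L (lebesgue_on {0<..<T}) (\<lambda>x. indicat_real {s<..<t} x * inner (g x) (emb \<psi>))"
    using st False
    by (intro weak_derivative_increment continuous_velocity int velocity_has_weak_derivative) auto
  also have "norm \<dots> \<le> integral\<^sup>L (lebesgue_on {0<..<T})
      (\<lambda>x. norm (emb \<psi>) * (indicat_real {s<..<t} x * norm (g x)))"
  proof (rule Bochner_Integration.integral_norm_bound_integral)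
    fix x
    show "norm (indicat_real {s<..<t} x * inner (g x) (emb \<psi>))
        \<le> norm (emb \<psi>) * (indicat_real {s<..<t} x * norm (g x))"
      using Cauchy_Schwarz_ineq2[of "g x" "emb \<psi>"] by (auto simp: indicator_def mult.commute)
  qed (use int int_g in \<open>auto intro!: integrable_indicator_mult integrable_mult_right\<close>)
  finally show ?thesis by (simp add: total_variation_def)
qed

text \<open>
  The difference quotient is the mean of the velocity over \<open>[s, t]\<close>, and the velocity deviates there
  from its value at \<open>t\<close> by at most the variation.
\<close>

lemma difference_quotient_consistency:
  assumes st: "0 \<le> s" "s < t" "t \<le> T"
  shows "\<bar>inner (emb (u \<mu> t) - emb (u \<mu> s)) (emb \<psi>) / (t - s) - velocity \<mu> \<psi> t\<bar>
    \<le> norm (emb \<psi>) * total_variation T g s t"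
proof -
  let ?M = "lebesgue_on {0<..<T}" and ?B = "norm (emb \<psi>) * total_variation T g s t"
  have int_g: "integrable ?M g"
    using g unfolding weak_second_derivative_def by (auto intro: in_L2_integrable)
  have int_v: "integrable ?M (\<lambda>x. indicat_real {s<..<t} x * velocity \<mu> \<psi> x)"
    by (intro integrable_indicator_mult continuous_integrable_open_interval continuous_velocity)
  have int_c: "integrable ?M (\<lambda>x. indicat_real {s<..<t} x * c)" for c :: real
    by (intro integrable_indicator_mult continuous_integrable_open_interval continuous_on_const)
  have ind: "integral\<^sup>L ?M (\<lambda>x. indicat_real {s<..<t} x * c) = (t - s) * c" for c
    using integral_indicator_open_interval[of s t T] st by simp
  have "inner (emb (u \<mu> t)) (emb \<psi>) - inner (emb (u \<mu> s)) (emb \<psi>)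
      = integral\<^sup>L ?M (\<lambda>x. indicat_real {s<..<t} x * velocity \<mu> \<psi> x)"
    by (rule weak_derivative_increment[OF continuous_on_inner[OF continuous_emb_u continuous_on_const]
          continuous_integrable_open_interval(1)[OF continuous_velocity] solution_has_weak_derivative_velocity st])
  then have diff: "inner (emb (u \<mu> t) - emb (u \<mu> s)) (emb \<psi>) - (t - s) * velocity \<mu> \<psi> t
      = integral\<^sup>L ?M (\<lambda>x. indicat_real {s<..<t} x * velocity \<mu> \<psi> x
        - indicat_real {s<..<t} x * velocity \<mu> \<psi> t)"
    by (simp only: Bochner_Integration.integral_diff[OF int_v int_c] ind inner_diff_left)
  have "norm (integral\<^sup>L ?M (\<lambda>x. indicat_real {s<..<t} x * velocity \<mu> \<psi> x
        - indicat_real {s<..<t} x * velocity \<mu> \<psi> t))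
      \<le> integral\<^sup>L ?M (\<lambda>x. indicat_real {s<..<t} x * ?B)"
  proof (rule Bochner_Integration.integral_norm_bound_integral)
    fix x
    show "norm (indicat_real {s<..<t} x * velocity \<mu> \<psi> x - indicat_real {s<..<t} x * velocity \<mu> \<psi> t)
        \<le> indicat_real {s<..<t} x * ?B"
    proof (cases "x \<in> {s<..<t}")
      case True
      then have "\<bar>velocity \<mu> \<psi> t - velocity \<mu> \<psi> x\<bar> \<le> norm (emb \<psi>) * total_variation T g x t"
        using st by (intro velocity_increment_le) auto
      also have "\<dots> \<le> ?B"
        using True by (intro mult_left_mono total_variation_mono[OF int_g]) auto
      finally show ?thesis using True by (simp add: abs_minus_commute)
    qed simp
  qed (intro Bochner_Integration.integrable_diff int_v int_c)+
  then have "\<bar>inner (emb (u \<mu> t) - emb (u \<mu> s)) (emb \<psi>) - (t - s) * velocity \<mu> \<psi> t\<bar>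
      \<le> (t - s) * ?B"
    by (simp only: diff[symmetric] ind real_norm_def)
  moreover have "inner (emb (u \<mu> t) - emb (u \<mu> s)) (emb \<psi>) / (t - s) - velocity \<mu> \<psi> t
      = (inner (emb (u \<mu> t) - emb (u \<mu> s)) (emb \<psi>) - (t - s) * velocity \<mu> \<psi> t) / (t - s)"
    using st by (simp add: diff_divide_distrib)
  ultimately show ?thesis
    using st by (simp add: abs_divide divide_le_eq mult.commute)
qed

end

end

end

section \<open>The truncation error of the POD basis\<close>

text \<open>
  Dimension counting inside the span of a finite set, in an ambient space that may have infinite dimension.
\<close>

lemma independent_card_ge_imp_spanning:
  fixes B C :: "'v::real_vector set"
  assumes "finite B" "independent C" "C \<subseteq> span B" "card B \<le> card C"
  shows "span B \<subseteq> span C"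
proof -
  have C: "finite C" using independent_span_bound[OF assms(1-3)] by blast
  have "B \<subseteq> span C"
  proof
    fix x assume x: "x \<in> B"
    show "x \<in> span C"
    proof (rule ccontr)
      assume nx: "x \<notin> span C"
      then have "independent (insert x C)" using assms(2) by (simp add: independent_insertI)
      moreover have "insert x C \<subseteq> span B" using x assms(3) by (auto intro: span_base)
      ultimately have "card (insert x C) \<le> card B" using independent_span_bound[OF assms(1)] by blast
      moreover have "x \<notin> C" using nx span_base by blast
      ultimately show False using C assms(4) by simp
    qed
  qed
  then show ?thesis by (simp add: span_minimal)
qed

context
  fixes m n :: nat and y :: "nat \<Rightarrow> 'v::real_inner" and lam :: "nat \<Rightarrow> real" and ev :: "nat \<Rightarrow> nat \<Rightarrow> real"
  assumes eigensystem: "positive_eigensystem m (correlation_matrix m y) n lam ev"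
begin

lemma eigenvalue_pos: "k \<in> {1..n} \<Longrightarrow> lam k > 0"
  using eigensystem unfolding positive_eigensystem_def by blast

text \<open>
  The eigenvalue equation says that the coefficients of the snapshots with respect to the POD basis
  are the entries of the eigenvectors, up to scaling.
\<close>

lemma inner_snapshot_pod_basis:
  assumes "k \<in> {1..n}" "i \<in> {0..2 * m}"
  shows "inner (y i) (pod_basis m y lam ev k) = sqrt (real (2 * m + 1) * lam k) * ev k i"
proof -
  have pos: "real (2 * m + 1) * lam k > 0" using eigenvalue_pos[OF assms(1)] by simp
  have "matrix_eigenvector m (correlation_matrix m y) (ev k) (lam k)"
    using eigensystem assms(1) unfolding positive_eigensystem_def by blast
  then have "(\<Sum>j=0..2 * m. correlation_matrix m y i j * ev k j) = lam k * ev k i"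
    using assms(2) unfolding matrix_eigenvector_def by blast
  then have "(\<Sum>j=0..2 * m. ev k j * inner (y i) (y j)) / real (2 * m + 1) = lam k * ev k i"
    by (simp add: correlation_matrix_def sum_divide_distrib mult.commute)
  then have "(\<Sum>j=0..2 * m. ev k j * inner (y i) (y j)) = real (2 * m + 1) * lam k * ev k i"
    by (simp add: field_simps)
  then have "inner (y i) (pod_basis m y lam ev k)
      = real (2 * m + 1) * lam k / sqrt (real (2 * m + 1) * lam k) * ev k i"
    by (simp add: pod_basis_def inner_sum_right)
  then show ?thesis using pos by (simp only: real_div_sqrt[OF less_imp_le])
qed

lemma pod_basis_orthonormal:
  assumes "k \<in> {1..n}" "l \<in> {1..n}"
  shows "inner (pod_basis m y lam ev k) (pod_basis m y lam ev l) = (if k = l then 1 else 0)"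
proof -
  let ?s = "\<lambda>k. sqrt (real (2 * m + 1) * lam k)"
  have "?s k > 0" using eigenvalue_pos[OF assms(1)] by (intro real_sqrt_gt_zero mult_pos_pos) auto
  have "inner (pod_basis m y lam ev k) (pod_basis m y lam ev l)
      = (1 / ?s k) * (\<Sum>j=0..2 * m. ev k j * inner (y j) (pod_basis m y lam ev l))"
    by (subst pod_basis_def) (simp add: inner_sum_left)
  also have "\<dots> = (1 / ?s k) * (\<Sum>j=0..2 * m. ev k j * (?s l * ev l j))"
    using inner_snapshot_pod_basis[OF assms(2)]
    by (intro arg_cong[where f = "\<lambda>z. (1 / ?s k) * z"] sum.cong) auto
  also have "\<dots> = (?s l / ?s k) * (\<Sum>j=0..2 * m. ev k j * ev l j)"
    by (simp only: sum_distrib_left) (simp add: mult_ac)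
  also have "(\<Sum>j=0..2 * m. ev k j * ev l j) = (if k = l then 1 else 0)"
    using eigensystem assms unfolding positive_eigensystem_def by blast
  finally show ?thesis using \<open>?s k > 0\<close> by auto
qed

lemma pod_basis_in_span: "pod_basis m y lam ev k \<in> span (y ` {0..2 * m})"
  unfolding pod_basis_def by (intro span_scale span_sum span_base) auto

lemma inj_on_pod_basis: "inj_on (pod_basis m y lam ev) {1..n}"
  using pod_basis_orthonormal by (intro inj_onI) (metis zero_neq_one)

text \<open>
  The POD vectors are orthonormal and as many as the dimension of the snapshot span, so they
  span it.
\<close>

lemma snapshot_expansion:
  assumes n: "n = snapshot_dim m y" and i: "i \<in> {0..2 * m}"
  shows "y i = (\<Sum>k=1..n. inner (y i) (pod_basis m y lam ev k) *\<^sub>R pod_basis m y lam ev k)"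
proof -
  let ?\<Psi> = "pod_basis m y lam ev ` {1..n}"
  have orth: "pairwise orthogonal ?\<Psi>"
    using pod_basis_orthonormal unfolding pairwise_def orthogonal_def by force
  have norm: "norm b = 1" if "b \<in> ?\<Psi>" for b
    using that pod_basis_orthonormal by (auto simp: norm_eq_1)
  then have "0 \<notin> ?\<Psi>" by (metis norm_zero zero_neq_one)
  then have indep: "independent ?\<Psi>" by (rule pairwise_orthogonal_independent[OF orth])
  obtain B where B: "B \<subseteq> y ` {0..2 * m}" "independent B" "y ` {0..2 * m} \<subseteq> span B"
      "card B = dim (y ` {0..2 * m})"
    by (rule basis_exists)
  have "finite B" using B(1) finite_subset by blast
  have span_eq: "span (y ` {0..2 * m}) \<subseteq> span B" using B(3) by (simp add: span_minimal)
  have "card ?\<Psi> = n" using card_image[OF inj_on_pod_basis] by simp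
  moreover have "card B = n" using n B(4) by (simp add: snapshot_dim_def)
  ultimately have "span B \<subseteq> span ?\<Psi>"
    using pod_basis_in_span span_eq \<open>finite B\<close> indep
    by (intro independent_card_ge_imp_spanning) auto
  then have "y i \<in> span ?\<Psi>" using B(3) i by blast
  from orthonormal_basis_expand[OF orth norm this]
  have "(\<Sum>b\<in>?\<Psi>. inner (y i) b *\<^sub>R b) = y i" by simp
  then show ?thesis by (subst (asm) sum.reindex[OF inj_on_pod_basis]) simp
qed

text \<open>
  Truncating the expansions of the snapshots leaves coefficients
  \<open>sqrt ((2m+1) \<lambda>\<^sub>k) * ev k i\<close> with \<open>k > l\<close>, whose squares sum over \<open>i\<close> to \<open>(2m+1) \<lambda>\<^sub>k\<close> since the eigenvectors
  are normalized.
\<close>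

lemma pod_truncation_error:
  assumes n: "n = snapshot_dim m y" and l: "l \<le> n"
  obtains p where "\<And>i. p i \<in> pod_space m y lam ev l"
    and "(\<Sum>i=0..2 * m. (norm (y i - p i))\<^sup>2) = real (2 * m + 1) * (\<Sum>j=l+1..n. lam j)"
proof -
  let ?\<psi> = "pod_basis m y lam ev"
  define p where "p = (\<lambda>i. \<Sum>k=1..l. inner (y i) (?\<psi> k) *\<^sub>R ?\<psi> k)"
  have p: "p i \<in> pod_space m y lam ev l" for i
    unfolding p_def pod_space_def by (intro span_sum span_scale span_base) auto
  have err: "(norm (y i - p i))\<^sup>2 = (\<Sum>k=l+1..n. real (2 * m + 1) * lam k * (ev k i * ev k i))"
    if i: "i \<in> {0..2 * m}" for i
  proof -
    have "y i = p i + (\<Sum>k=l+1..n. inner (y i) (?\<psi> k) *\<^sub>R ?\<psi> k)"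
      using l sum.ub_add_nat[of 1 l "\<lambda>k. inner (y i) (?\<psi> k) *\<^sub>R ?\<psi> k" "n - l"]
      unfolding p_def by (subst snapshot_expansion[OF n i]) simp
    then have "y i - p i = (\<Sum>k=l+1..n. inner (y i) (?\<psi> k) *\<^sub>R ?\<psi> k)"
      by (metis add_diff_cancel_left')
    moreover have "pairwise (\<lambda>k j. orthogonal (inner (y i) (?\<psi> k) *\<^sub>R ?\<psi> k)
        (inner (y i) (?\<psi> j) *\<^sub>R ?\<psi> j)) {l+1..n}"
      using pod_basis_orthonormal by (auto simp: pairwise_def orthogonal_def)
    ultimately have "(norm (y i - p i))\<^sup>2 = (\<Sum>k=l+1..n. (norm (inner (y i) (?\<psi> k) *\<^sub>R ?\<psi> k))\<^sup>2)"
      by (simp only: norm_sum_Pythagorean[OF finite_atLeastAtMost])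
    also have "\<dots> = (\<Sum>k=l+1..n. real (2 * m + 1) * lam k * (ev k i * ev k i))"
    proof (rule sum.cong)
      fix k assume "k \<in> {l+1..n}"
      then have k: "k \<in> {1..n}" by simp
      then have "norm (?\<psi> k) = 1" using pod_basis_orthonormal by (simp add: norm_eq_1)
      then have "(norm (inner (y i) (?\<psi> k) *\<^sub>R ?\<psi> k))\<^sup>2 = (sqrt (real (2 * m + 1) * lam k) * ev k i)\<^sup>2"
        using inner_snapshot_pod_basis[OF k i] by simp
      also have "\<dots> = real (2 * m + 1) * lam k * (ev k i * ev k i)"
        using eigenvalue_pos[OF k] by (simp add: power_mult_distrib power2_eq_square)
      finally show "(norm (inner (y i) (?\<psi> k) *\<^sub>R ?\<psi> k))\<^sup>2
          = real (2 * m + 1) * lam k * (ev k i * ev k i)" .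
    qed simp
    finally show ?thesis .
  qed
  have "(\<Sum>i=0..2 * m. (norm (y i - p i))\<^sup>2)
      = (\<Sum>i=0..2 * m. \<Sum>k=l+1..n. real (2 * m + 1) * lam k * (ev k i * ev k i))"
    using err by (rule sum.cong[OF refl])
  also have "\<dots> = (\<Sum>k=l+1..n. real (2 * m + 1) * lam k * (\<Sum>i=0..2 * m. ev k i * ev k i))"
    by (subst sum.swap) (simp only: sum_distrib_left)
  also have "\<dots> = (\<Sum>k=l+1..n. real (2 * m + 1) * lam k)"
  proof (rule sum.cong)
    fix k assume "k \<in> {l+1..n}"
    then have "(\<Sum>i=0..2 * m. ev k i * ev k i) = 1"
      using eigensystem unfolding positive_eigensystem_def by simp
    then show "real (2 * m + 1) * lam k * (\<Sum>i=0..2 * m. ev k i * ev k i) = real (2 * m + 1) * lam k"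
      by simp
  qed simp
  finally have "(\<Sum>i=0..2 * m. (norm (y i - p i))\<^sup>2) = real (2 * m + 1) * (\<Sum>j=l+1..n. lam j)"
    by (simp only: sum_distrib_left)
  with p show thesis by (rule that)
qed

end

section \<open>The Ritz projection\<close>

context
  fixes a :: "'v::real_inner \<Rightarrow> 'v \<Rightarrow> real \<Rightarrow> real" and \<mu> b k :: real and B :: "'v set"
  assumes bilinear: "bilinear (\<lambda>v w. a v w \<mu>)"
    and bounded: "\<And>v w. \<bar>a v w \<mu>\<bar> \<le> b * norm v * norm w"
    and coercive: "\<And>v. a v v \<mu> \<ge> k * (norm v)\<^sup>2"
    and k_pos: "k > 0"
    and finite_B: "finite B"
begin

lemmas form_simps = bilinear_ladd[OF bilinear] bilinear_lsub[OF bilinear] bilinear_lmul[OF bilinear]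
  bilinear_radd[OF bilinear] bilinear_rsub[OF bilinear] bilinear_rmul[OF bilinear]
  bilinear_lzero[OF bilinear] bilinear_rzero[OF bilinear]

lemma coercive_imp_zero:
  assumes "a v v \<mu> = 0"
  shows "v = 0"
proof -
  have "k * (norm v)\<^sup>2 \<le> 0" using coercive[of v] assms by simp
  then show ?thesis using k_pos by (simp add: mult_le_0_iff)
qed

text \<open>
  On a basis \<open>C\<close> of the finite-dimensional space the operator \<open>G w = (\<Sum>c\<in>C. a(w, c) c)\<close> is injective by
  coercivity, hence surjective by counting dimensions. The vector \<open>G w\<close> determines the functional \<open>a(w, \<psi>)\<close> of \<open>\<psi>\<close> on the
  space, so a preimage of \<open>G v\<close> there has the required property.
\<close>

lemma galerkin_solution_exists: "\<exists>w\<in>span B. \<forall>\<psi>\<in>span B. a w \<psi> \<mu> = a v \<psi> \<mu>"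
proof -
  obtain C where C: "C \<subseteq> B" "independent C" "B \<subseteq> span C" by (metis maximal_independent_subset)
  have finC: "finite C" using C(1) finite_B finite_subset by blast
  have span_C: "span C = span B"
    using C(1,3) by (metis span_minimal span_mono subset_antisym subspace_span)
  define G where "G = (\<lambda>w. \<Sum>c\<in>C. a w c \<mu> *\<^sub>R c)"
  have lin: "linear G"
    unfolding G_def
    by (rule linearI) (simp_all add: form_simps scaleR_left.add sum.distrib scaleR_sum_right)
  have zero: "\<forall>c\<in>C. a w c \<mu> = 0" if "G w = 0" for w
    using that C(2) finC unfolding G_def by (metis independentD order_refl)
  have test: "\<forall>\<psi>\<in>span B. a w \<psi> \<mu> = 0" if "\<forall>c\<in>C. a w c \<mu> = 0" for w
  proof
    fix \<psi> assume "\<psi> \<in> span B"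
    then have "\<psi> \<in> span C" by (simp add: span_C)
    then show "a w \<psi> \<mu> = 0"
      by (induction rule: span_induct_alt) (use that in \<open>auto simp: form_simps\<close>)
  qed
  have inj: "inj_on G (span C)"
  proof (rule inj_onI)
    fix x z assume xz: "x \<in> span C" "z \<in> span C" "G x = G z"
    then have "G (x - z) = 0" using lin by (simp add: linear_diff)
    moreover have "x - z \<in> span B" using xz span_C by (metis span_diff)
    ultimately have "a (x - z) (x - z) \<mu> = 0" using zero test by blast
    then show "x = z" using coercive_imp_zero by fastforce
  qed
  have "span C \<subseteq> span (G ` C)"
  proof (rule independent_card_ge_imp_spanning[OF finC])
    show "independent (G ` C)"
      by (rule linear_independent_injective_image[OF lin C(2) inj])
    show "G ` C \<subseteq> span C" unfolding G_def
      by (intro image_subsetI span_sum span_scale) (rule span_base)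
    show "card C \<le> card (G ` C)"
      using inj_on_subset[OF inj span_superset] by (simp add: card_image)
  qed
  then have "span C \<subseteq> G ` span C" using linear_span_image[OF lin] by simp
  moreover have "G v \<in> span C" unfolding G_def by (intro span_sum span_scale span_base)
  ultimately obtain w where w: "w \<in> span C" "G v = G w" by blast
  then have "G (w - v) = 0" using lin by (simp add: linear_diff)
  then have "\<forall>\<psi>\<in>span B. a (w - v) \<psi> \<mu> = 0" using zero test by blast
  then show ?thesis using w(1) span_C by (auto simp: form_simps)
qed

lemma ritz_projection_unique:
  assumes "w \<in> span B" "\<forall>\<psi>\<in>span B. a w \<psi> \<mu> = a v \<psi> \<mu>"
  shows "ritz_projection a \<mu> (span B) v = w"
  unfolding ritz_projection_def
proof (rule the_equality)
  fix w' assume w': "w' \<in> span B \<and> (\<forall>\<psi>\<in>span B. a w' \<psi> \<mu> = a v \<psi> \<mu>)"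
  then have "w' - w \<in> span B" using assms(1) by (simp add: span_diff)
  then have "a (w' - w) (w' - w) \<mu> = 0" using w' assms
    by (simp only: bilinear_lsub[OF bilinear])
  then show "w' = w" using coercive_imp_zero by fastforce
qed (use assms in simp)

lemma ritz_projection_in: "ritz_projection a \<mu> (span B) v \<in> span B"
  and ritz_projection_eq: "\<psi> \<in> span B \<Longrightarrow> a (ritz_projection a \<mu> (span B) v) \<psi> \<mu> = a v \<psi> \<mu>"
  using galerkin_solution_exists[of v] ritz_projection_unique by auto

lemma linear_ritz_projection: "linear (ritz_projection a \<mu> (span B))"
  by (rule linearI; rule ritz_projection_unique)
     (auto simp: form_simps ritz_projection_eq intro!: span_add span_scale ritz_projection_in)

text \<open>
  Galerkin orthogonality replaces one of the two error factors in \<open>a(\<rho>, \<rho>)\<close> by \<open>v - p\<close>.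
\<close>

lemma cea_estimate:
  assumes p: "p \<in> span B"
  shows "norm (v - ritz_projection a \<mu> (span B) v) \<le> b / k * norm (v - p)"
proof -
  let ?\<rho> = "v - ritz_projection a \<mu> (span B) v"
  have "ritz_projection a \<mu> (span B) v - p \<in> span B"
    using p ritz_projection_in by (simp add: span_diff)
  then have "a ?\<rho> (ritz_projection a \<mu> (span B) v - p) \<mu> = 0"
    by (simp add: bilinear_lsub[OF bilinear] ritz_projection_eq)
  then have "a ?\<rho> ?\<rho> \<mu> = a ?\<rho> (v - p) \<mu>"
    by (simp add: bilinear_rsub[OF bilinear])
  then have "k * (norm ?\<rho>)\<^sup>2 \<le> b * norm ?\<rho> * norm (v - p)"
    using coercive[of ?\<rho>] bounded[of ?\<rho> "v - p"] by linarith
  then have "norm ?\<rho> * (k * norm ?\<rho>) \<le> norm ?\<rho> * (b * norm (v - p))"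
    by (simp add: power2_eq_square mult_ac)
  moreover have "0 \<le> b * norm (v - p)" if "norm ?\<rho> = 0"
  proof (cases "v = p")
    case False
    have "0 \<le> b * norm (v - p) * norm (v - p)" using bounded[of "v - p" "v - p"] by linarith
    then show ?thesis using False by (simp add: zero_le_mult_iff)
  qed simp
  ultimately have "k * norm ?\<rho> \<le> b * norm (v - p)"
    by (cases "norm ?\<rho> = 0") (use mult_le_cancel_left_pos[of "norm ?\<rho>"] in auto)
  then show ?thesis using k_pos by (simp add: field_simps)
qed

end

section \<open>The discrete energy estimate\<close>

text \<open>
  For \<open>0 \<le> x \<le> 1/2\<close> one has \<open>1 \<le> (1 - x) (1 + 2x) \<le> (1 - x) exp (2x)\<close>, so that every implicit step costs at most a
  factor \<open>exp (2x)\<close>.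
\<close>

lemma discrete_gronwall:
  fixes A d :: "nat \<Rightarrow> real"
  assumes x: "0 \<le> x" "x \<le> 1 / 2" and A: "A 0 \<ge> 0" and d: "\<And>k. d k \<ge> 0"
    and step: "\<And>k. k \<in> {1..m} \<Longrightarrow> (1 - x) * A k \<le> A (k - 1) + d k"
    and k: "k \<le> m"
  shows "A k \<le> exp (2 * x * real k) * (A 0 + (\<Sum>j=1..k. d j))"
  using k
proof (induction k)
  case 0
  then show ?case by simp
next
  case (Suc k)
  define R where "R = A 0 + (\<Sum>j=1..k. d j)"
  have R: "R \<ge> 0" unfolding R_def using A d by (intro add_nonneg_nonneg sum_nonneg) auto
  have IH: "A k \<le> exp (2 * x * real k) * R" using Suc unfolding R_def by simp
  have "1 \<le> exp (2 * x * real k)" using x by simp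
  then have "d (Suc k) \<le> exp (2 * x * real k) * d (Suc k)"
    using d mult_right_mono[of 1 "exp (2 * x * real k)" "d (Suc k)"] by simp
  with IH have sum: "A k + d (Suc k) \<le> exp (2 * x * real k) * (R + d (Suc k))"
    by (simp add: distrib_left)
  have "(1 - x) * A (Suc k) \<le> exp (2 * x * real k) * (R + d (Suc k))"
    using step[of "Suc k"] Suc.prems sum by simp
  moreover have "1 \<le> (1 - x) * exp (2 * x)"
  proof -
    have "0 \<le> x * (1 - 2 * x)" using x by (intro mult_nonneg_nonneg) auto
    then have "1 \<le> (1 - x) * (1 + 2 * x)" by (simp add: algebra_simps)
    also have "\<dots> \<le> (1 - x) * exp (2 * x)" using x by (intro mult_left_mono exp_ge_add_one_self) auto
    finally show ?thesis .
  qed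
  moreover have "0 \<le> exp (2 * x * real k) * (R + d (Suc k))" using R d[of "Suc k"] by simp
  ultimately have "(1 - x) * A (Suc k) \<le> ((1 - x) * exp (2 * x)) * (exp (2 * x * real k) * (R + d (Suc k)))"
    using mult_right_mono[of 1 "(1 - x) * exp (2 * x)" "exp (2 * x * real k) * (R + d (Suc k))"] by linarith
  then have "(1 - x) * A (Suc k) \<le> (1 - x) * (exp (2 * x) * (exp (2 * x * real k) * (R + d (Suc k))))"
    by (simp only: mult.assoc)
  then have "A (Suc k) \<le> exp (2 * x) * (exp (2 * x * real k) * (R + d (Suc k)))"
    using x by (simp only: mult_le_cancel_left_pos)
  also have "\<dots> = exp (2 * x * real (Suc k)) * (A 0 + (\<Sum>j=1..Suc k. d j))"
    by (simp add: R_def distrib_left exp_add add.assoc)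
  finally show ?case .
qed

text \<open>
  Young's inequality applied to each product on the right-hand side of the energy inequality. The
  whole coercivity term is spent on \<open>L * V * X\<close>; this is what makes the factor in front of
  \<open>X\<^sup>2\<close> fit the step size condition exactly. Here \<open>X\<close> and \<open>Z\<close> stand for the \<open>H\<close>-norms of the
  discrete error at two consecutive times, \<open>V\<close> for its \<open>V\<close>-norm, \<open>r\<close> and \<open>D\<close> for the projection error and its
  difference quotient, and \<open>e\<close> for the consistency error.
\<close>

lemma energy_absorption:
  fixes X Z V r e D L k \<Delta> :: real
  assumes "k > 0" "\<Delta> > 0" "L \<ge> 0"
    and energy: "(X\<^sup>2 - Z\<^sup>2) / (2 * \<Delta>) + k * V\<^sup>2 \<le> L * (V + r) * X + X * e + D * X"
  shows "(1 - (1 + L + L\<^sup>2 / (2 * k)) * \<Delta>) * X\<^sup>2 \<le> Z\<^sup>2 + 2 * \<Delta> * (L / 2 * r\<^sup>2 + D\<^sup>2 + e\<^sup>2)"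
proof -
  have y1: "L * V * X \<le> k * V\<^sup>2 + L\<^sup>2 / (4 * k) * X\<^sup>2"
  proof -
    define s where "s = L * X / (2 * k)"
    have LX: "L * X = 2 * k * s" using \<open>k > 0\<close> by (simp add: s_def)
    have "0 \<le> k * (V - s)\<^sup>2" using \<open>k > 0\<close> by simp
    then have "(2 * k * s) * V \<le> k * V\<^sup>2 + k * s\<^sup>2"
      by (simp add: power2_eq_square algebra_simps)
    moreover have "k * s\<^sup>2 = L\<^sup>2 / (4 * k) * X\<^sup>2"
      using \<open>k > 0\<close> by (simp add: s_def power2_eq_square)
    moreover have "L * V * X = (2 * k * s) * V" using LX by (simp add: mult_ac)
    ultimately show ?thesis by linarith
  qed
  have "0 \<le> L * (r - X)\<^sup>2" using assms by simp
  then have y2: "L * r * X \<le> L / 2 * r\<^sup>2 + L / 2 * X\<^sup>2"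
    by (simp add: power2_eq_square algebra_simps)
  have "0 \<le> (X - (e + D))\<^sup>2" "0 \<le> (e - D)\<^sup>2" by auto
  then have y3: "X * e + D * X \<le> X\<^sup>2 / 2 + D\<^sup>2 + e\<^sup>2"
    by (simp add: power2_eq_square algebra_simps)
  have "(X\<^sup>2 - Z\<^sup>2) / (2 * \<Delta>) \<le> (L\<^sup>2 / (4 * k) * X\<^sup>2 + L / 2 * X\<^sup>2 + X\<^sup>2 / 2) + (L / 2 * r\<^sup>2 + D\<^sup>2 + e\<^sup>2)"
    using energy y1 y2 y3 by (simp add: algebra_simps)
  then have "X\<^sup>2 - Z\<^sup>2 \<le> ((L\<^sup>2 / (4 * k) * X\<^sup>2 + L / 2 * X\<^sup>2 + X\<^sup>2 / 2) + (L / 2 * r\<^sup>2 + D\<^sup>2 + e\<^sup>2)) * (2 * \<Delta>)"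
    using \<open>\<Delta> > 0\<close> by (simp add: pos_divide_le_eq)
  also have "\<dots> = (1 + L + L\<^sup>2 / (2 * k)) * \<Delta> * X\<^sup>2 + 2 * \<Delta> * (L / 2 * r\<^sup>2 + D\<^sup>2 + e\<^sup>2)"
    using \<open>k > 0\<close> by (simp add: field_simps)
  finally show ?thesis by (simp add: algebra_simps)
qed

context parametrized_problem
begin

context
  fixes \<mu> :: real and m :: nat and B :: "'v set" and U :: "nat \<Rightarrow> 'v" and g :: "real \<Rightarrow> 'h"
  assumes \<mu>: "\<mu> \<in> P" and m: "m \<ge> 1" and finite_B: "finite B"
    and scheme: "reduced_scheme emb T f \<phi> a F \<mu> m (span B) U"
    and g: "weak_second_derivative T (\<lambda>t. emb (u \<mu> t)) g"
begin

interpretation emb: bounded_linear emb by (rule emb_bounded_linear)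

abbreviation "\<Delta>t \<equiv> time_step T m"
abbreviation "tt \<equiv> time_node T m"
abbreviation "R \<equiv> ritz_projection a \<mu> (span B)"

lemmas ritz_assms = bilinear_a[OF \<mu>] A1[OF \<mu>] A2[OF \<mu>] \<kappa>(2)[OF \<mu>] finite_B
lemmas R_in = ritz_projection_in
  [where a = a and \<mu> = \<mu> and b = "\<beta> \<mu>" and k = "\<kappa> \<mu>" and B = B, OF ritz_assms]
lemmas R_eq = ritz_projection_eq
  [where a = a and \<mu> = \<mu> and b = "\<beta> \<mu>" and k = "\<kappa> \<mu>" and B = B, OF ritz_assms]
lemmas R_linear = linear_ritz_projection
  [where a = a and \<mu> = \<mu> and b = "\<beta> \<mu>" and k = "\<kappa> \<mu>" and B = B, OF ritz_assms]
lemmas R_cea = cea_estimate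
  [where a = a and \<mu> = \<mu> and b = "\<beta> \<mu>" and k = "\<kappa> \<mu>" and B = B, OF ritz_assms]

definition discrete_error :: "nat \<Rightarrow> 'v" where
  "discrete_error k = U k - R (u \<mu> (tt k))"

definition ritz_error :: "nat \<Rightarrow> 'v" where
  "ritz_error k = u \<mu> (tt k) - R (u \<mu> (tt k))"

lemma discrete_error_in:
  assumes "k \<le> m"
  shows "discrete_error k \<in> span B"
  using scheme assms R_in unfolding discrete_error_def reduced_scheme_def
  by (intro span_diff) auto

text \<open>
  Since \<open>U 0\<close> is the \<open>H\<close>-projection of \<open>\<phi>\<close>, the initial discrete error is the \<open>H\<close>-projection of \<open>\<phi> - R \<phi>\<close>.
\<close>

lemma initial_discrete_error:
  "norm (emb (discrete_error 0)) \<le> norm (emb \<phi> - emb (R \<phi>))"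
proof -
  let ?x = "emb (discrete_error 0)"
  have u0: "u \<mu> (tt 0) = \<phi>" using initial_value[OF \<mu>] by (simp add: time_node_def)
  have "inner (emb (U 0)) ?x = inner (emb \<phi>) ?x"
    using scheme discrete_error_in[of 0] unfolding reduced_scheme_def by blast
  then have "inner ?x ?x = inner (emb \<phi> - emb (R \<phi>)) ?x"
    by (subst (1) discrete_error_def) (simp add: u0 emb.diff inner_diff_left)
  also have "\<dots> \<le> norm (emb \<phi> - emb (R \<phi>)) * norm ?x" by (rule norm_cauchy_schwarz)
  finally have "norm ?x * norm ?x \<le> norm (emb \<phi> - emb (R \<phi>)) * norm ?x"
    by (simp add: dot_square_norm power2_eq_square)
  then show ?thesis by (cases "norm ?x = 0") (auto simp: mult_le_cancel_right)
qed

text \<open>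
  Test the scheme and the equation at \<open>t\<^sub>k\<close> with the discrete error itself and subtract. The
  difference quotient of \<open>U\<close> is split into those of the discrete error, of \<open>u\<close> and of the Ritz
  error; the second is compared with the velocity.
\<close>

lemma discrete_error_step:
  assumes k: "k \<in> {1..m}"
  defines "c \<equiv> 1 + L\<^sub>F \<mu> + (L\<^sub>F \<mu>)\<^sup>2 / (2 * \<kappa> \<mu>)"
  shows "(1 - c * \<Delta>t) * (norm (emb (discrete_error k)))\<^sup>2
    \<le> (norm (emb (discrete_error (k - 1))))\<^sup>2
      + 2 * \<Delta>t * (L\<^sub>F \<mu> / 2 * (norm (ritz_error k))\<^sup>2
                   + (norm (emb (backward_diff T m ritz_error k)))\<^sup>2
                   + (total_variation T g (tt (k - 1)) (tt k))\<^sup>2)"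
proof -
  have \<Delta>: "\<Delta>t > 0" by (rule time_step_pos[OF T_pos m])
  let ?\<theta> = "discrete_error k" and ?uk = "u \<mu> (tt k)"
  let ?x = "emb ?\<theta>" and ?z = "emb (discrete_error (k - 1))"
  let ?e = "total_variation T g (tt (k - 1)) (tt k)" and ?d = "emb (backward_diff T m ritz_error k)"
  have \<theta>: "?\<theta> \<in> span B" using k by (intro discrete_error_in) auto
  have eq: "inner (emb (backward_diff T m U k)) ?x + a (U k) ?\<theta> \<mu> + inner (F (U k) \<mu>) ?x
      = inner (f (tt k)) ?x"
    using scheme k \<theta> unfolding reduced_scheme_def by blast
  have consistency: "\<bar>inner (emb ?uk - emb (u \<mu> (tt (k - 1)))) ?x / \<Delta>t - velocity \<mu> ?\<theta> (tt k)\<bar>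
      \<le> norm ?x * ?e"
  proof -
    have "tt k - tt (k - 1) = \<Delta>t" using m k by (intro time_node_simps) auto
    moreover have "0 \<le> tt (k - 1)" "tt k \<le> T" using k by (auto intro!: time_node_bounds T_pos m)
    ultimately show ?thesis
      using difference_quotient_consistency[OF \<mu> g, of "tt (k - 1)" "tt k" ?\<theta>] \<Delta> by simp
  qed
  have U_split: "backward_diff T m U k = (1 / \<Delta>t) *\<^sub>R (?\<theta> - discrete_error (k - 1))
      + (1 / \<Delta>t) *\<^sub>R (?uk - u \<mu> (tt (k - 1))) - backward_diff T m ritz_error k"
    by (simp add: backward_diff_def discrete_error_def ritz_error_def divide_inverse
        scaleR_right_distrib[symmetric] scaleR_right_diff_distrib[symmetric])
  have "inner (emb (backward_diff T m U k)) ?x = inner (?x - ?z) ?x / \<Delta>t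
      + inner (emb ?uk - emb (u \<mu> (tt (k - 1)))) ?x / \<Delta>t - inner ?d ?x"
    unfolding U_split by (simp add: emb.add emb.diff emb.scaleR inner_add_left inner_diff_left)
  moreover have "a (U k) ?\<theta> \<mu> = a ?\<theta> ?\<theta> \<mu> + a ?uk ?\<theta> \<mu>"
    using R_eq[OF \<theta>] by (subst (2) discrete_error_def) (simp add: bilinear_lsub[OF bilinear_a[OF \<mu>]])
  ultimately have "inner (?x - ?z) ?x / \<Delta>t + a ?\<theta> ?\<theta> \<mu>
      = velocity \<mu> ?\<theta> (tt k) - inner (emb ?uk - emb (u \<mu> (tt (k - 1)))) ?x / \<Delta>t + inner ?d ?x
        - inner (F (U k) \<mu> - F ?uk \<mu>) ?x"
    using eq by (simp add: velocity_def inner_diff_left)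
  moreover have "((norm ?x)\<^sup>2 - (norm ?z)\<^sup>2) / (2 * \<Delta>t) \<le> inner (?x - ?z) ?x / \<Delta>t"
  proof -
    have "inner ?z ?x \<le> ((norm ?z)\<^sup>2 + (norm ?x)\<^sup>2) / 2"
      using norm_cauchy_schwarz[of ?z ?x] zero_le_power2[of "norm ?z - norm ?x"]
      by (simp add: power2_eq_square algebra_simps)
    then have "((norm ?x)\<^sup>2 - (norm ?z)\<^sup>2) / 2 \<le> inner (?x - ?z) ?x"
      by (simp add: inner_diff_left dot_square_norm)
    from divide_right_mono[OF this less_imp_le[OF \<Delta>]] show ?thesis by simp
  qed
  moreover have "\<kappa> \<mu> * (norm ?\<theta>)\<^sup>2 \<le> a ?\<theta> ?\<theta> \<mu>" by (rule A2[OF \<mu>])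
  moreover have "inner ?d ?x \<le> norm ?d * norm ?x" by (rule norm_cauchy_schwarz)
  moreover have "- inner (F (U k) \<mu> - F ?uk \<mu>) ?x \<le> L\<^sub>F \<mu> * (norm ?\<theta> + norm (ritz_error k)) * norm ?x"
  proof -
    have "- inner (F (U k) \<mu> - F ?uk \<mu>) ?x \<le> norm (F (U k) \<mu> - F ?uk \<mu>) * norm ?x"
      using Cauchy_Schwarz_ineq2[of "F (U k) \<mu> - F ?uk \<mu>" ?x] by linarith
    also have "\<dots> \<le> (L\<^sub>F \<mu> * norm (U k - ?uk)) * norm ?x"
      by (intro mult_right_mono F1[OF \<mu>]) auto
    also have "U k - ?uk = ?\<theta> - ritz_error k" by (simp add: discrete_error_def ritz_error_def)
    also have "(L\<^sub>F \<mu> * norm (?\<theta> - ritz_error k)) * norm ?x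
        \<le> L\<^sub>F \<mu> * (norm ?\<theta> + norm (ritz_error k)) * norm ?x"
      by (intro mult_right_mono mult_left_mono norm_triangle_ineq4 L\<^sub>F(2)[OF \<mu>]) auto
    finally show ?thesis .
  qed
  ultimately have "((norm ?x)\<^sup>2 - (norm ?z)\<^sup>2) / (2 * \<Delta>t) + \<kappa> \<mu> * (norm ?\<theta>)\<^sup>2
      \<le> L\<^sub>F \<mu> * (norm ?\<theta> + norm (ritz_error k)) * norm ?x + norm ?x * ?e + norm ?d * norm ?x"
    using consistency by linarith
  then show ?thesis unfolding c_def
    by (rule energy_absorption[OF \<kappa>(2)[OF \<mu>] \<Delta> L\<^sub>F(2)[OF \<mu>]])
qed

lemma discrete_error_bound:
  defines "c \<equiv> 1 + L\<^sub>F \<mu> + (L\<^sub>F \<mu>)\<^sup>2 / (2 * \<kappa> \<mu>)"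
  assumes small: "c * \<Delta>t \<le> 1 / 2" and k: "k \<le> m"
  shows "(norm (emb (discrete_error k)))\<^sup>2 \<le> exp (2 * c * T) *
    ((norm (emb \<phi> - emb (R \<phi>)))\<^sup>2
      + 2 * \<Delta>t * (\<Sum>j=1..m. L\<^sub>F \<mu> / 2 * (norm (ritz_error j))\<^sup>2
                   + (norm (emb (backward_diff T m ritz_error j)))\<^sup>2
                   + (total_variation T g (tt (j - 1)) (tt j))\<^sup>2))"
proof -
  have \<Delta>: "\<Delta>t > 0" by (rule time_step_pos[OF T_pos m])
  have L: "L\<^sub>F \<mu> \<ge> 0" by (rule L\<^sub>F(2)[OF \<mu>])
  have c: "c \<ge> 0" unfolding c_def using L \<kappa>(2)[OF \<mu>] by simp
  define d where "d = (\<lambda>j. 2 * \<Delta>t * (L\<^sub>F \<mu> / 2 * (norm (ritz_error j))\<^sup>2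
      + (norm (emb (backward_diff T m ritz_error j)))\<^sup>2 + (total_variation T g (tt (j - 1)) (tt j))\<^sup>2))"
  have d: "d j \<ge> 0" for j unfolding d_def using \<Delta> L by simp
  have "(norm (emb (discrete_error k)))\<^sup>2
      \<le> exp (2 * (c * \<Delta>t) * real k) * ((norm (emb (discrete_error 0)))\<^sup>2 + (\<Sum>j=1..k. d j))"
  proof (rule discrete_gronwall[OF _ small _ d _ k])
    show "0 \<le> c * \<Delta>t" using c \<Delta> by simp
    show "(1 - c * \<Delta>t) * (norm (emb (discrete_error j)))\<^sup>2
        \<le> (norm (emb (discrete_error (j - 1))))\<^sup>2 + d j" if "j \<in> {1..m}" for j
      using discrete_error_step[OF that] unfolding d_def c_def .
  qed simp
  also have "\<dots> \<le> exp (2 * c * T) * ((norm (emb \<phi> - emb (R \<phi>)))\<^sup>2 + (\<Sum>j=1..m. d j))"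
  proof (intro mult_mono add_mono power_mono initial_discrete_error)
    have "\<Delta>t * real k \<le> T"
      using time_node_bounds(2)[OF T_pos m k] by (simp add: time_node_def mult.commute)
    then have "2 * c * (\<Delta>t * real k) \<le> 2 * c * T" using c by (intro mult_left_mono) auto
    then show "exp (2 * (c * \<Delta>t) * real k) \<le> exp (2 * c * T)" by (simp add: mult_ac)
    show "(\<Sum>j=1..k. d j) \<le> (\<Sum>j=1..m. d j)" using k d by (intro sum_mono2) auto
  qed (auto intro!: add_nonneg_nonneg sum_nonneg d)
  finally show ?thesis by (simp only: d_def sum_distrib_left)
qed

text \<open>
  The snapshots at the times \<open>t\<^sub>k\<close> bound the Ritz errors and the remaining snapshots bound their
  difference quotients. The number of snapshots is at most \<open>3m\<close>, which the average over \<open>m\<close>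
  time steps compensates.
\<close>

lemma mean_square_error_bound:
  defines "c \<equiv> 1 + L\<^sub>F \<mu> + (L\<^sub>F \<mu>)\<^sup>2 / (2 * \<kappa> \<mu>)"
  assumes small: "c * \<Delta>t \<le> 1 / 2"
    and p: "\<And>i. p i \<in> span B"
    and pod: "(\<Sum>i=0..2 * m. (norm (snapshot T m (u \<mu>) i - p i))\<^sup>2) \<le> real (2 * m + 1) * \<Lambda>"
  defines "r \<equiv> (\<beta> \<mu> / \<kappa> \<mu>)\<^sup>2" and "K \<equiv> integral\<^sup>L (lebesgue_on {0<..<T}) (\<lambda>x. (norm (g x))\<^sup>2)"
  shows "(1 / real m) * (\<Sum>k=1..m. (norm (emb (u \<mu> (tt k)) - emb (U k)))\<^sup>2)
    \<le> 6 * \<alpha> * r * \<Lambda> + 2 * exp (2 * c * T) * ((norm (emb \<phi> - emb (R \<phi>)))\<^sup>2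
        + 6 * T * (L\<^sub>F \<mu> / 2 + \<alpha>) * r * \<Lambda> + 2 * K * \<Delta>t\<^sup>2)"
proof -
  have \<Delta>: "\<Delta>t > 0" by (rule time_step_pos[OF T_pos m])
  have L: "L\<^sub>F \<mu> \<ge> 0" by (rule L\<^sub>F(2)[OF \<mu>])
  have r: "r \<ge> 0" unfolding r_def by simp
  have mT: "real m * \<Delta>t = T" using m by (simp add: time_step_def)
  let ?y = "snapshot T m (u \<mu>)"
  let ?E = "\<lambda>i. (norm (?y i - R (?y i)))\<^sup>2"
  have cea: "?E i \<le> r * (norm (?y i - p i))\<^sup>2" for i
    using power_mono[OF R_cea[OF p, of "?y i"], of 2 i] unfolding r_def
    by (simp add: power_mult_distrib power_divide)
  have y_low: "?y j - R (?y j) = ritz_error j" if "j \<le> m" for j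
    using that by (simp add: snapshot_def ritz_error_def)
  have y_high: "?y (j + m) - R (?y (j + m)) = backward_diff T m ritz_error j" if "j \<ge> 1" for j
    using that by (simp add: snapshot_def ritz_error_def backward_diff_def linear_scale[OF R_linear]
        linear_diff[OF R_linear] scaleR_right_diff_distrib)
  have "(\<Sum>j=1..m. (norm (ritz_error j))\<^sup>2) + (\<Sum>j=1..m. (norm (backward_diff T m ritz_error j))\<^sup>2)
      = (\<Sum>j=1..m. ?E j) + (\<Sum>j=1+m..m+m. ?E j)"
    unfolding sum.shift_bounds_cl_nat_ivl by (intro arg_cong2[where f = "(+)"] sum.cong) (auto simp: y_low y_high)
  also have "\<dots> = (\<Sum>j=1..2 * m. ?E j)"
    using sum.ub_add_nat[of 1 m ?E m] m by (simp add: mult_2)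
  also have "\<dots> \<le> (\<Sum>j=0..2 * m. ?E j)" by (rule sum_mono2) auto
  also have "\<dots> \<le> (\<Sum>j=0..2 * m. r * (norm (?y j - p j))\<^sup>2)" by (intro sum_mono cea)
  also have "\<dots> \<le> r * (real (2 * m + 1) * \<Lambda>)"
    unfolding sum_distrib_left[symmetric] using pod r by (rule mult_left_mono)
  finally have total: "(\<Sum>j=1..m. (norm (ritz_error j))\<^sup>2)
      + (\<Sum>j=1..m. (norm (backward_diff T m ritz_error j))\<^sup>2) \<le> r * (real (2 * m + 1) * \<Lambda>)" .
  have "0 \<le> real (2 * m + 1) * \<Lambda>" by (rule order_trans[OF sum_nonneg pod]) auto
  then have \<Lambda>: "\<Lambda> \<ge> 0" by (simp add: zero_le_mult_iff)
  have "real (2 * m + 1) * \<Lambda> \<le> (3 * real m) * \<Lambda>" using m \<Lambda> by (intro mult_right_mono) auto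
  then have "r * (real (2 * m + 1) * \<Lambda>) \<le> r * ((3 * real m) * \<Lambda>)" using r by (rule mult_left_mono)
  with total have total3: "(\<Sum>j=1..m. (norm (ritz_error j))\<^sup>2)
      + (\<Sum>j=1..m. (norm (backward_diff T m ritz_error j))\<^sup>2) \<le> 3 * real m * r * \<Lambda>"
    by (simp add: mult_ac)
  have S2: "0 \<le> (\<Sum>j=1..m. (norm (backward_diff T m ritz_error j))\<^sup>2)"
    and S1: "0 \<le> (\<Sum>j=1..m. (norm (ritz_error j))\<^sup>2)" by (auto intro!: sum_nonneg)
  have b1: "(\<Sum>j=1..m. (norm (ritz_error j))\<^sup>2) \<le> 3 * real m * r * \<Lambda>"
    and b2: "(\<Sum>j=1..m. (norm (backward_diff T m ritz_error j))\<^sup>2) \<le> 3 * real m * r * \<Lambda>"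
    using total3 S1 S2 by linarith+
  have tv: "(\<Sum>j=1..m. (total_variation T g (tt (j - 1)) (tt j))\<^sup>2) \<le> \<Delta>t * K"
    unfolding K_def using g
    by (intro sum_total_variation_square_le T_pos m) (auto simp: weak_second_derivative_def)
  define Q where "Q = (\<Sum>j=1..m. L\<^sub>F \<mu> / 2 * (norm (ritz_error j))\<^sup>2
                   + (norm (emb (backward_diff T m ritz_error j)))\<^sup>2
                   + (total_variation T g (tt (j - 1)) (tt j))\<^sup>2)"
  have "Q \<le> (\<Sum>j=1..m. L\<^sub>F \<mu> / 2 * (norm (ritz_error j))\<^sup>2
                   + \<alpha> * (norm (backward_diff T m ritz_error j))\<^sup>2
                   + (total_variation T g (tt (j - 1)) (tt j))\<^sup>2)"
    unfolding Q_def by (intro sum_mono add_mono emb_bound) auto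
  also have "\<dots> = L\<^sub>F \<mu> / 2 * (\<Sum>j=1..m. (norm (ritz_error j))\<^sup>2)
      + \<alpha> * (\<Sum>j=1..m. (norm (backward_diff T m ritz_error j))\<^sup>2)
      + (\<Sum>j=1..m. (total_variation T g (tt (j - 1)) (tt j))\<^sup>2)"
    by (simp only: sum.distrib sum_distrib_left)
  also have "\<dots> \<le> L\<^sub>F \<mu> / 2 * (3 * real m * r * \<Lambda>) + \<alpha> * (3 * real m * r * \<Lambda>) + \<Delta>t * K"
    using b1 b2 tv L \<alpha>_pos by (intro add_mono mult_left_mono) auto
  finally have "2 * \<Delta>t * Q \<le> 2 * \<Delta>t *
      (L\<^sub>F \<mu> / 2 * (3 * real m * r * \<Lambda>) + \<alpha> * (3 * real m * r * \<Lambda>) + \<Delta>t * K)"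
    using \<Delta> by (intro mult_left_mono) auto
  also have "\<dots> = 6 * (real m * \<Delta>t) * (L\<^sub>F \<mu> / 2 + \<alpha>) * r * \<Lambda> + 2 * K * \<Delta>t\<^sup>2"
    by (simp add: power2_eq_square algebra_simps)
  finally have Q: "2 * \<Delta>t * Q \<le> 6 * T * (L\<^sub>F \<mu> / 2 + \<alpha>) * r * \<Lambda> + 2 * K * \<Delta>t\<^sup>2"
    unfolding mT .
  define M where "M = exp (2 * c * T) * ((norm (emb \<phi> - emb (R \<phi>)))\<^sup>2
        + 6 * T * (L\<^sub>F \<mu> / 2 + \<alpha>) * r * \<Lambda> + 2 * K * \<Delta>t\<^sup>2)"
  have disc: "(norm (emb (discrete_error k)))\<^sup>2 \<le> M" if "k \<in> {1..m}" for k
  proof -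
    have "(norm (emb (discrete_error k)))\<^sup>2
        \<le> exp (2 * c * T) * ((norm (emb \<phi> - emb (R \<phi>)))\<^sup>2 + 2 * \<Delta>t * Q)"
      using discrete_error_bound[of k] small that unfolding c_def Q_def by simp
    also have "\<dots> \<le> M" unfolding M_def using Q by (intro mult_left_mono) auto
    finally show ?thesis .
  qed
  have "(norm (emb (u \<mu> (tt k)) - emb (U k)))\<^sup>2 \<le> 2 * \<alpha> * (norm (ritz_error k))\<^sup>2 + 2 * M"
    if k: "k \<in> {1..m}" for k
  proof -
    have "emb (u \<mu> (tt k)) - emb (U k) = emb (ritz_error k) - emb (discrete_error k)"
      by (simp add: ritz_error_def discrete_error_def emb.diff)
    then have "norm (emb (u \<mu> (tt k)) - emb (U k))
        \<le> norm (emb (ritz_error k)) + norm (emb (discrete_error k))"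
      by (simp add: norm_triangle_ineq4)
    then have "(norm (emb (u \<mu> (tt k)) - emb (U k)))\<^sup>2
        \<le> (norm (emb (ritz_error k)) + norm (emb (discrete_error k)))\<^sup>2"
      by (intro power_mono) auto
    also have "\<dots> \<le> 2 * (norm (emb (ritz_error k)))\<^sup>2 + 2 * (norm (emb (discrete_error k)))\<^sup>2"
      using zero_le_power2[of "norm (emb (ritz_error k)) - norm (emb (discrete_error k))"]
      by (simp add: power2_eq_square algebra_simps)
    finally show ?thesis using emb_bound[of "ritz_error k"] disc[OF k] by linarith
  qed
  then have "(\<Sum>k=1..m. (norm (emb (u \<mu> (tt k)) - emb (U k)))\<^sup>2)
      \<le> (\<Sum>k=1..m. 2 * \<alpha> * (norm (ritz_error k))\<^sup>2 + 2 * M)" by (rule sum_mono)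
  also have "\<dots> = 2 * \<alpha> * (\<Sum>k=1..m. (norm (ritz_error k))\<^sup>2) + 2 * M * real m"
    by (simp add: sum.distrib sum_distrib_left)
  also have "\<dots> \<le> 2 * \<alpha> * (3 * real m * r * \<Lambda>) + 2 * M * real m"
    using b1 \<alpha>_pos by (intro add_right_mono mult_left_mono) auto
  finally have "(\<Sum>k=1..m. (norm (emb (u \<mu> (tt k)) - emb (U k)))\<^sup>2)
      \<le> (6 * \<alpha> * r * \<Lambda> + 2 * M) * real m" by (simp add: algebra_simps)
  then have "(1 / real m) * (\<Sum>k=1..m. (norm (emb (u \<mu> (tt k)) - emb (U k)))\<^sup>2)
      \<le> 6 * \<alpha> * r * \<Lambda> + 2 * M" using m by (simp add: divide_le_eq)
  then show ?thesis unfolding M_def by (simp only: mult.assoc)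
qed

end

end

section \<open>The error estimate\<close>

text \<open>
  Choosing one weak second derivative makes the constant a function of the solution alone.
\<close>

definition second_derivative_energy :: "real \<Rightarrow> (real \<Rightarrow> 'h::{banach,second_countable_topology}) \<Rightarrow> real" where
  "second_derivative_energy T w =
     integral\<^sup>L (lebesgue_on {0<..<T}) (\<lambda>x. (norm ((SOME g. weak_second_derivative T w g) x))\<^sup>2)"

definition error_constant ::
    "('v \<Rightarrow> 'h::{banach,second_countable_topology}) \<Rightarrow> (real \<Rightarrow> 'v)
      \<Rightarrow> real \<Rightarrow> real \<Rightarrow> real \<Rightarrow> real \<Rightarrow> real \<Rightarrow> real" where
  "error_constant emb w \<alpha> b k L T =
     6 * \<alpha> * (b / k)\<^sup>2 + 2 * exp (2 * (1 + L + L\<^sup>2 / (2 * k)) * T)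
       * (1 + 6 * T * (L / 2 + \<alpha>) * (b / k)\<^sup>2 + 2 * second_derivative_energy T (\<lambda>t. emb (w t)))"

lemma second_derivative_energy_nonneg: "second_derivative_energy T w \<ge> 0"
  unfolding second_derivative_energy_def by simp

lemma error_constant_pos:
  assumes "\<alpha> > 0" "L \<ge> 0" "T > 0"
  shows "error_constant emb w \<alpha> b k L T > 0"
  unfolding error_constant_def
  using assms second_derivative_energy_nonneg[of T "\<lambda>t. emb (w t)"]
  by (intro add_nonneg_pos mult_pos_pos add_pos_nonneg mult_nonneg_nonneg) auto

lemma in_W22_imp_weak_second_derivative:
  assumes "in_W22 T w"
  shows "\<exists>g. weak_second_derivative T w g"
  using assms unfolding in_W22_def weak_second_derivative_def by blast

lemma (in parametrized_problem) reduced_scheme_error: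
  assumes \<mu>: "\<mu> \<in> P" and m: "m \<ge> 1" and step: "time_step_condition T P \<kappa> L\<^sub>F \<mu> m"
    and sys: "positive_eigensystem m (correlation_matrix m (snapshot T m (u \<mu>))) n lam ev"
    and n: "n = snapshot_dim m (snapshot T m (u \<mu>))" and l: "l \<le> n"
  defines "S \<equiv> pod_space m (snapshot T m (u \<mu>)) lam ev l"
  assumes scheme: "reduced_scheme emb T f \<phi> a F \<mu> m S U"
  shows "(1 / real m) * (\<Sum>k=1..m. (norm (emb (u \<mu> (time_node T m k)) - emb (U k)))\<^sup>2)
    \<le> error_constant emb (u \<mu>) \<alpha> (\<beta> \<mu>) (\<kappa> \<mu>) (L\<^sub>F \<mu>) T *
      ((norm (emb \<phi> - emb (ritz_projection a \<mu> S \<phi>)))\<^sup>2 + (\<Sum>j=l+1..n. lam j) + (time_step T m)\<^sup>2)"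
proof -
  define g where "g = (SOME g. weak_second_derivative T (\<lambda>t. emb (u \<mu> t)) g)"
  have g: "weak_second_derivative T (\<lambda>t. emb (u \<mu> t)) g"
    unfolding g_def using in_W22_imp_weak_second_derivative[OF u_W22[OF \<mu>]] by (rule someI_ex)
  define B where "B = pod_basis m (snapshot T m (u \<mu>)) lam ev ` {1..l}"
  have S: "S = span B" by (simp add: S_def pod_space_def B_def)
  define \<Lambda> where "\<Lambda> = (\<Sum>j=l+1..n. lam j)"
  obtain p where p: "\<And>i. p i \<in> S"
    and pod: "(\<Sum>i=0..2 * m. (norm (snapshot T m (u \<mu>) i - p i))\<^sup>2) = real (2 * m + 1) * \<Lambda>"
    using pod_truncation_error[OF sys n l] unfolding S_def \<Lambda>_def by metis
  define r c K X where "r = (\<beta> \<mu> / \<kappa> \<mu>)\<^sup>2" and "c = 1 + L\<^sub>F \<mu> + (L\<^sub>F \<mu>)\<^sup>2 / (2 * \<kappa> \<mu>)"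
    and "K = second_derivative_energy T (\<lambda>t. emb (u \<mu> t))"
    and "X = (norm (emb \<phi> - emb (ritz_projection a \<mu> S \<phi>)))\<^sup>2"
  have small: "c * time_step T m \<le> 1 / 2"
    using step unfolding time_step_condition_def c_def by simp
  have "(1 / real m) * (\<Sum>k=1..m. (norm (emb (u \<mu> (time_node T m k)) - emb (U k)))\<^sup>2)
      \<le> 6 * \<alpha> * r * \<Lambda> + 2 * exp (2 * c * T) * (X + 6 * T * (L\<^sub>F \<mu> / 2 + \<alpha>) * r * \<Lambda> + 2 * K * (time_step T m)\<^sup>2)"
    unfolding r_def c_def K_def X_def second_derivative_energy_def g_def[symmetric] S
    by (rule mean_square_error_bound[where p = p,
            OF \<mu> m _ scheme[unfolded S] g small[unfolded c_def] p[unfolded S]])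
       (simp add: B_def, simp only: pod order_refl)
  also have "\<dots> \<le> (6 * \<alpha> * r + 2 * exp (2 * c * T) * (1 + 6 * T * (L\<^sub>F \<mu> / 2 + \<alpha>) * r + 2 * K))
      * (X + \<Lambda> + (time_step T m)\<^sup>2)"
  proof -
    have nonneg: "r \<ge> 0" "K \<ge> 0" "X \<ge> 0" "(time_step T m)\<^sup>2 \<ge> 0" "\<alpha> \<ge> 0" "T \<ge> 0" "L\<^sub>F \<mu> \<ge> 0"
      using \<alpha>_pos T_pos L\<^sub>F(2)[OF \<mu>] second_derivative_energy_nonneg
      by (auto simp: r_def K_def X_def)
    have \<Lambda>: "\<Lambda> \<ge> 0" unfolding \<Lambda>_def
      using eigenvalue_pos[OF sys] by (intro sum_nonneg less_imp_le) auto
    \<comment> \<open>Bounding every contribution by the whole sum turns the weighted sum into a product.\<close>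
    let ?S = "X + \<Lambda> + (time_step T m)\<^sup>2"
    have \<Lambda>_le: "6 * \<alpha> * r * \<Lambda> \<le> 6 * \<alpha> * r * ?S"
      using nonneg \<Lambda> by (intro mult_left_mono) auto
    have "6 * T * (L\<^sub>F \<mu> / 2 + \<alpha>) * r * \<Lambda> \<le> 6 * T * (L\<^sub>F \<mu> / 2 + \<alpha>) * r * ?S"
      using nonneg \<Lambda> by (intro mult_left_mono) auto
    moreover have "2 * K * (time_step T m)\<^sup>2 \<le> 2 * K * ?S"
      using nonneg \<Lambda> by (intro mult_left_mono) auto
    moreover have "X \<le> ?S" using nonneg \<Lambda> by simp
    ultimately have sum: "X + 6 * T * (L\<^sub>F \<mu> / 2 + \<alpha>) * r * \<Lambda> + 2 * K * (time_step T m)\<^sup>2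
        \<le> ?S + 6 * T * (L\<^sub>F \<mu> / 2 + \<alpha>) * r * ?S + 2 * K * ?S"
      by linarith
    have "6 * \<alpha> * r * \<Lambda> + 2 * exp (2 * c * T) * (X + 6 * T * (L\<^sub>F \<mu> / 2 + \<alpha>) * r * \<Lambda> + 2 * K * (time_step T m)\<^sup>2)
        \<le> 6 * \<alpha> * r * ?S + 2 * exp (2 * c * T) * (?S + 6 * T * (L\<^sub>F \<mu> / 2 + \<alpha>) * r * ?S + 2 * K * ?S)"
      by (rule add_mono[OF \<Lambda>_le mult_left_mono[OF sum]]) simp
    also have "\<dots> = (6 * \<alpha> * r + 2 * exp (2 * c * T) * (1 + 6 * T * (L\<^sub>F \<mu> / 2 + \<alpha>) * r + 2 * K)) * ?S"
      by (simp only: distrib_left distrib_right mult_1 mult.assoc)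
    finally show ?thesis .
  qed
  finally show ?thesis
    unfolding error_constant_def r_def c_def K_def X_def \<Lambda>_def .
qed

theorem theorem3p5:
  fixes emb :: "'v::{real_inner,banach,second_countable_topology}
                  \<Rightarrow> 'h::{real_inner,banach,second_countable_topology}"
  assumes "gelfand_triple emb"
  shows "\<exists>C :: (real \<Rightarrow> 'v) \<Rightarrow> real \<Rightarrow> real \<Rightarrow> real \<Rightarrow> real \<Rightarrow> real \<Rightarrow> real.
    \<forall>\<alpha> T P f \<phi> a F \<beta> \<kappa> L\<^sub>F \<omega>\<^sub>a \<omega>\<^sub>F u \<mu>\<^sub>0.
      parametrized_problem emb \<alpha> T P f \<phi> a F \<beta> \<kappa> L\<^sub>F \<omega>\<^sub>a \<omega>\<^sub>F u \<and> \<mu>\<^sub>0 \<in> P \<longrightarrow>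
      C (u \<mu>\<^sub>0) \<alpha> (\<beta> \<mu>\<^sub>0) (\<kappa> \<mu>\<^sub>0) (L\<^sub>F \<mu>\<^sub>0) T > 0 \<and>
      (\<forall>m y n lam ev l U.
        m \<ge> 1 \<and> time_step_condition T P \<kappa> L\<^sub>F \<mu>\<^sub>0 m \<and>
        y = snapshot T m (u \<mu>\<^sub>0) \<and> n = snapshot_dim m y \<and>
        positive_eigensystem m (correlation_matrix m y) n lam ev \<and>
        l \<in> {1..n} \<and>
        reduced_scheme emb T f \<phi> a F \<mu>\<^sub>0 m (pod_space m y lam ev l) U \<longrightarrow>
        (1 / real m) * (\<Sum>k=1..m. (norm (emb (u \<mu>\<^sub>0 (time_node T m k)) - emb (U k)))\<^sup>2)
          \<le> C (u \<mu>\<^sub>0) \<alpha> (\<beta> \<mu>\<^sub>0) (\<kappa> \<mu>\<^sub>0) (L\<^sub>F \<mu>\<^sub>0) T *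
            ((norm (emb \<phi> - emb (ritz_projection a \<mu>\<^sub>0 (pod_space m y lam ev l) \<phi>)))\<^sup>2
             + (\<Sum>j=l+1..n. lam j) + (time_step T m)\<^sup>2))"
proof (rule exI[of _ "error_constant emb"], intro allI impI conjI)
  fix \<alpha> T P f \<phi> a F \<beta> \<kappa> L\<^sub>F \<omega>\<^sub>a \<omega>\<^sub>F u \<mu>\<^sub>0
  assume asm: "parametrized_problem emb \<alpha> T P f \<phi> a F \<beta> \<kappa> L\<^sub>F \<omega>\<^sub>a \<omega>\<^sub>F u \<and> \<mu>\<^sub>0 \<in> P"
  then interpret parametrized_problem emb \<alpha> T P f \<phi> a F \<beta> \<kappa> L\<^sub>F \<omega>\<^sub>a \<omega>\<^sub>F u by blast
  have \<mu>\<^sub>0: "\<mu>\<^sub>0 \<in> P" using asm by blast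
  show "error_constant emb (u \<mu>\<^sub>0) \<alpha> (\<beta> \<mu>\<^sub>0) (\<kappa> \<mu>\<^sub>0) (L\<^sub>F \<mu>\<^sub>0) T > 0"
    by (rule error_constant_pos[OF \<alpha>_pos L\<^sub>F(2)[OF \<mu>\<^sub>0] T_pos])
next
  fix \<alpha> T P f \<phi> a F \<beta> \<kappa> L\<^sub>F \<omega>\<^sub>a \<omega>\<^sub>F u \<mu>\<^sub>0 m y n lam ev l U
  assume asm: "parametrized_problem emb \<alpha> T P f \<phi> a F \<beta> \<kappa> L\<^sub>F \<omega>\<^sub>a \<omega>\<^sub>F u \<and> \<mu>\<^sub>0 \<in> P"
    and rom: "m \<ge> 1 \<and> time_step_condition T P \<kappa> L\<^sub>F \<mu>\<^sub>0 m \<and>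
        y = snapshot T m (u \<mu>\<^sub>0) \<and> n = snapshot_dim m y \<and>
        positive_eigensystem m (correlation_matrix m y) n lam ev \<and>
        l \<in> {1..n} \<and>
        reduced_scheme emb T f \<phi> a F \<mu>\<^sub>0 m (pod_space m y lam ev l) U"
  from asm interpret parametrized_problem emb \<alpha> T P f \<phi> a F \<beta> \<kappa> L\<^sub>F \<omega>\<^sub>a \<omega>\<^sub>F u by blast
  have y: "y = snapshot T m (u \<mu>\<^sub>0)" using rom by blast
  show "(1 / real m) * (\<Sum>k=1..m. (norm (emb (u \<mu>\<^sub>0 (time_node T m k)) - emb (U k)))\<^sup>2)
      \<le> error_constant emb (u \<mu>\<^sub>0) \<alpha> (\<beta> \<mu>\<^sub>0) (\<kappa> \<mu>\<^sub>0) (L\<^sub>F \<mu>\<^sub>0) T *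
        ((norm (emb \<phi> - emb (ritz_projection a \<mu>\<^sub>0 (pod_space m y lam ev l) \<phi>)))\<^sup>2
         + (\<Sum>j=l+1..n. lam j) + (time_step T m)\<^sup>2)"
    unfolding y by (rule reduced_scheme_error) (use asm rom y in auto)
qed

end
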